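(* Let $\mathcal{V}$ and its Poisson bracket, $F(\zeta)=\mathrm{P}^2+\mathrm{Q}\mathrm{R}=\zeta^{2\mathrm{g}+2}+\sum_{j=0}^{2\mathrm{g}+1}c_j\zeta^j$ and $H_j=c_j$ ($0\le j\le\mathrm{g}-1$) be as in the context, and restrict to the level set $c_{2\mathrm{g}+1}=0$. For $\mathcal{L}=\begin{pmatrix}\mathrm{P}&\mathrm{R}\\ \mathrm{Q}&-\mathrm{P}\end{pmatrix}$ in this level set, write $\mathrm{Q}(\zeta)=-4d_0\big(\zeta^{\mathrm{g}}-v_0\zeta^{\mathrm{g}-1}+O(\zeta^{\mathrm{g}-2})\big)$ with $d_0\neq0$, and define $\tilde{\mathcal{L}}=\begin{pmatrix}\tilde{\mathrm{P}}&\tilde{\mathrm{R}}\\ \tilde{\mathrm{Q}}&-\tilde{\mathrm{P}}\end{pmatrix}$ by $$(\zeta+v_0)\big(\tilde{\mathrm{P}}-\mathrm{P}\big)=-2d_0\mathrm{R}-\tfrac12\tilde{\mathrm{Q}},\qquad 2d_0\big(\tilde{\mathrm{P}}+\mathrm{P}\big)=-(\zeta+v_0)\mathrm{Q},\qquad -4d_0\tilde{\mathrm{R}}=\mathrm{Q},$$ equivalently $\mathcal{L}\mathcal{M}=\mathcal{M}\tilde{\mathcal{L}}$ with $\mathcal{M}(\zeta)=\begin{pmatrix}\zeta+v_0&1/2\\-2d_0&0\end{pmatrix}$. Then the map $\mathcal{L}\mapsto\tilde{\mathcal{L}}$ is an integrable Poisson map on the space of Lax matrices: it preserves the Poisson bracket,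 all the Casimirs $c_{\mathrm{g}},\dots,c_{2\mathrm{g}+1}$ and the $\mathrm{g}$ Hamiltonians $H_0,\dots,H_{\mathrm{g}-1}$, which are in involution.
   Context: $\mathcal{V}$ is the affine space of matrices $\begin{pmatrix}\mathrm{P}(\zeta)&\mathrm{R}(\zeta)\\ \mathrm{Q}(\zeta)&-\mathrm{P}(\zeta)\end{pmatrix}$ with $\mathrm{P}$ monic of degree $\mathrm{g}+1$, $\mathrm{R}$ monic of degree $\mathrm{g}$, $\mathrm{Q}$ of degree at most $\mathrm{g}$, coordinates being the non-fixed coefficients, with the linear Poisson bracket given by the generating identities (in independent variables $\zeta,\eta$): $\{\mathrm{P}(\zeta),\mathrm{P}(\eta)\}=0=\{\mathrm{R}(\zeta),\mathrm{R}(\eta)\}$, $\{\mathrm{P}(\zeta),\mathrm{Q}(\eta)\}=2\frac{\mathrm{Q}(\zeta)-\mathrm{Q}(\eta)}{\zeta-\eta}$, $\{\mathrm{P}(\zeta),\mathrm{R}(\eta)\}=-2\frac{\mathrm{R}(\zeta)-\mathrm{R}(\eta)}{\zeta-\eta}$, $\{\mathrm{Q}(\zeta),\mathrm{Q}(\eta)\}=-4(\mathrm{Q}(\zeta)-\mathrm{Q}(\eta))$, $\{\mathrm{Q}(\zeta),\mathrm{R}(\eta)\}=4\frac{\mathrm{P}(\zeta)-\mathrm{P}(\eta)}{\zeta-\eta}-4\mathrm{R}(\eta)$. The coefficients $c_{\mathrm{g}},\dots,c_{2\mathrm{g}+1}$ of $F$ are Casimirs of this bracket. A Poisson map is a map $\Phi$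 with $\{f\circ\Phi,h\circ\Phi\}=\{f,h\}\circ\Phi$ for all functions $f,h$; it is integrable if in addition it preserves a maximal family of independent first integrals in involution (here the $H_j$, on symplectic leaves of dimension $2\mathrm{g}$). *)

theory Defs
  imports "HOL-Analysis.Analysis"
begin

text \<open>
  The genus is \<open>g = CARD('g) \<ge> 1\<close>, and the ground field is any \<open>'a :: real_normed_field\<close>
  (in particular the reals or the complex numbers). The index type below names the \<open>3g + 2\<close>
  non-fixed coefficients: \<open>Inl _\<close> those of \<open>P\<close>, \<open>Inr (Inl _)\<close> those of \<open>Q\<close>,
  \<open>Inr (Inr _)\<close> those of \<open>R\<close>. An element of \<open>'g option\<close> stands for an exponent in \<open>{0..g}\<close>,
  with \<open>None\<close> standing for \<open>g\<close>, and an element of \<open>'g\<close> for an exponent in \<open>{0..<g}\<close>.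
\<close>

type_synonym 'g coord = "'g option + 'g option + 'g"
type_synonym ('a, 'g) lax = "('a, 'g coord) vec"

definition expo :: "'g::finite option \<Rightarrow> nat" where
  "expo i = (case i of None \<Rightarrow> CARD('g) | Some k \<Rightarrow> to_nat_on (UNIV :: 'g set) k)"

lemma expo_None [simp]: "expo (None :: 'g::finite option) = CARD('g)"
  by (simp add: expo_def)

lemma bij_betw_expo_Some: "bij_betw (\<lambda>k :: 'g::finite. expo (Some k)) UNIV {..<CARD('g)}"
  using to_nat_on_finite[of "UNIV :: 'g set"] by (simp add: expo_def)

lemma bij_betw_expo: "bij_betw (expo :: 'g::finite option \<Rightarrow> nat) UNIV {..CARD('g)}"
proof -
  have "bij_betw (expo :: 'g option \<Rightarrow> nat) (range Some) {..<CARD('g)}"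
    using bij_betw_expo_Some[where 'g = 'g]
    by (auto simp: bij_betw_def inj_on_def image_image)
  then have "bij_betw (expo :: 'g option \<Rightarrow> nat) (range Some \<union> {None}) ({..<CARD('g)} \<union> {CARD('g)})"
    by (rule bij_betw_combine) (auto simp: bij_betw_def)
  moreover have "range Some \<union> {None} = (UNIV :: 'g option set)"
    by (auto simp: UNIV_option_conv)
  moreover have "{..<CARD('g)} \<union> {CARD('g)} = {..CARD('g)}" by auto
  ultimately show ?thesis by simp
qed

lemma sum_expo: "(\<Sum>i\<in>UNIV. f (expo (i :: 'g::finite option))) = (\<Sum>n\<le>CARD('g). f n)"
  using sum.reindex_bij_betw[OF bij_betw_expo] .

lemma sum_expo_Some: "(\<Sum>k\<in>UNIV. f (expo (Some (k :: 'g::finite)))) = (\<Sum>n<CARD('g). f n)"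
  using sum.reindex_bij_betw[OF bij_betw_expo_Some] .

lemma expo_le: "expo (i :: 'g::finite option) \<le> CARD('g)"
  using bij_betw_expo[where 'g = 'g] by (auto simp: bij_betw_def)

lemma expo_Some_less: "expo (Some (k :: 'g::finite)) < CARD('g)"
  using bij_betw_expo_Some[where 'g = 'g] by (auto simp: bij_betw_def)

lemma inj_expo: "expo i = expo j \<longleftrightarrow> i = j"
  using bij_betw_expo by (metis bij_betw_def injD)

definition laxP :: "('a::real_normed_field, 'g::finite) lax \<Rightarrow> 'a poly" where
  "laxP x = monom 1 (CARD('g) + 1) + (\<Sum>i\<in>UNIV. monom (x $ Inl i) (expo i))"

definition laxQ :: "('a::real_normed_field, 'g::finite) lax \<Rightarrow> 'a poly" where
  "laxQ x = (\<Sum>i\<in>UNIV. monom (x $ Inr (Inl i)) (expo i))"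

definition laxR :: "('a::real_normed_field, 'g::finite) lax \<Rightarrow> 'a poly" where
  "laxR x = monom 1 CARD('g) + (\<Sum>k\<in>UNIV. monom (x $ Inr (Inr k)) (expo (Some k)))"

lemma coeff_laxP:
  fixes x :: "('a::real_normed_field, 'g::finite) lax"
  shows "coeff (laxP x) (expo i) = x $ Inl i" "coeff (laxP x) (CARD('g) + 1) = 1"
    "n > CARD('g) + 1 \<Longrightarrow> coeff (laxP x) n = 0"
proof -
  show "coeff (laxP x) (expo i) = x $ Inl i"
    using expo_le[of i] by (simp add: laxP_def coeff_sum inj_expo)
  have "expo j < n" if "n > CARD('g)" for n and j :: "'g option" using expo_le[of j] that by simp
  then show "coeff (laxP x) (CARD('g) + 1) = 1" "n > CARD('g) + 1 \<Longrightarrow> coeff (laxP x) n = 0"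
    by (auto simp: laxP_def coeff_sum intro!: sum.neutral) (metis less_add_one less_irrefl add_lessD1 Suc_eq_plus1 Suc_lessD)+
qed

lemma coeff_laxQ:
  fixes x :: "('a::real_normed_field, 'g::finite) lax"
  shows "coeff (laxQ x) (expo i) = x $ Inr (Inl i)" "n > CARD('g) \<Longrightarrow> coeff (laxQ x) n = 0"
proof -
  show "coeff (laxQ x) (expo i) = x $ Inr (Inl i)"
    by (simp add: laxQ_def coeff_sum inj_expo)
  have "expo j < n" if "n > CARD('g)" for n and j :: "'g option" using expo_le[of j] that by simp
  then show "n > CARD('g) \<Longrightarrow> coeff (laxQ x) n = 0"
    by (auto simp: laxQ_def coeff_sum intro!: sum.neutral) (metis less_irrefl)
qed

lemma coeff_laxR:
  fixes x :: "('a::real_normed_field, 'g::finite) lax"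
  shows "coeff (laxR x) (expo (Some k)) = x $ Inr (Inr k)" "coeff (laxR x) CARD('g) = 1"
    "n > CARD('g) \<Longrightarrow> coeff (laxR x) n = 0"
proof -
  show "coeff (laxR x) (expo (Some k)) = x $ Inr (Inr k)"
    using expo_Some_less[of k] by (simp add: laxR_def coeff_sum inj_expo)
  have "expo (Some j) < n" if "n \<ge> CARD('g)" for n and j :: 'g using expo_Some_less[of j] that by simp
  then show "coeff (laxR x) CARD('g) = 1" "n > CARD('g) \<Longrightarrow> coeff (laxR x) n = 0"
    by (auto simp: laxR_def coeff_sum intro!: sum.neutral) (metis less_irrefl less_imp_le order_refl)+
qed

lemma degree_laxP: "degree (laxP (x :: ('a::real_normed_field, 'g::finite) lax)) = CARD('g) + 1"
  using coeff_laxP(2,3)[where x = x] by (intro antisym degree_le le_degree) auto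

lemma degree_laxQ: "degree (laxQ (x :: ('a::real_normed_field, 'g::finite) lax)) \<le> CARD('g)"
  using coeff_laxQ(2)[where x = x] by (intro degree_le) auto

lemma degree_laxR: "degree (laxR (x :: ('a::real_normed_field, 'g::finite) lax)) = CARD('g)"
  using coeff_laxR(2,3)[where x = x] by (intro antisym degree_le le_degree) auto

lemma poly_eqI_expo:
  assumes "degree p \<le> CARD('g)" "degree q \<le> CARD('g)"
    and "\<And>i :: 'g::finite option. coeff p (expo i) = coeff q (expo i)"
  shows "p = q"
proof (rule poly_eqI)
  fix n
  show "coeff p n = coeff q n"
  proof (cases "n \<le> CARD('g)")
    case True
    then obtain i :: "'g option" where "n = expo i"
      using bij_betw_expo[where 'g = 'g] by (auto simp: bij_betw_def)
    then show ?thesis using assms(3) by simp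
  next
    case False
    then show ?thesis using assms(1,2) by (simp add: coeff_eq_0)
  qed
qed

text \<open>The coordinates parametrize exactly the space of Lax matrices, bijectively.\<close>

lemma range_lax:
  "range (\<lambda>x :: ('a::real_normed_field, 'g::finite) lax. (laxP x, laxQ x, laxR x)) =
     {(P, Q, R). degree P = CARD('g) + 1 \<and> lead_coeff P = 1 \<and>
                 degree Q \<le> CARD('g) \<and> degree R = CARD('g) \<and> lead_coeff R = 1}"
    (is "?A = ?B")
proof
  show "?A \<subseteq> ?B"
    using coeff_laxP(2) coeff_laxR(2) by (auto simp: degree_laxP degree_laxQ degree_laxR)
  show "?B \<subseteq> ?A"
  proof safe
    fix P Q R :: "'a poly"
    assume P: "degree P = CARD('g) + 1" "lead_coeff P = 1"
      and Q: "degree Q \<le> CARD('g)" and R: "degree R = CARD('g)" "lead_coeff R = 1"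
    define x :: "('a, 'g) lax" where "x = (\<chi> i. case i of Inl i \<Rightarrow> coeff P (expo i)
       | Inr (Inl i) \<Rightarrow> coeff Q (expo i) | Inr (Inr k) \<Rightarrow> coeff R (expo (Some k)))"
    have "laxQ x = Q"
      using Q degree_laxQ[of x] by (intro poly_eqI_expo[where 'g = 'g]) (auto simp: coeff_laxQ x_def)
    moreover have "laxR x = R"
    proof (rule poly_eqI_expo[where 'g = 'g])
      show "coeff (laxR x) (expo i) = coeff R (expo i)" for i :: "'g option"
        using R coeff_laxR(2)[of x] by (cases i) (auto simp: coeff_laxR x_def)
    qed (use R in \<open>auto simp: degree_laxR\<close>)
    moreover have "laxP x = P"
    proof (rule poly_eqI)
      fix n
      consider "n \<le> CARD('g)" | "n = CARD('g) + 1" | "n > CARD('g) + 1" by linarith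
      then show "coeff (laxP x) n = coeff P n"
      proof cases
        case 1
        then obtain i :: "'g option" where "n = expo i"
          using bij_betw_expo[where 'g = 'g] by (auto simp: bij_betw_def)
        then show ?thesis by (simp add: coeff_laxP x_def)
      next
        case 2
        then show ?thesis using P coeff_laxP(2)[of x] by simp
      next
        case 3
        then show ?thesis using P coeff_laxP(3)[of n x] by (simp add: coeff_eq_0)
      qed
    qed
    ultimately show "(P, Q, R) \<in> ?A" by auto
  qed
qed

lemma inj_lax: "inj (\<lambda>x :: ('a::real_normed_field, 'g::finite) lax. (laxP x, laxQ x, laxR x))"
proof (rule injI)
  fix x y :: "('a, 'g) lax"
  assume "(laxP x, laxQ x, laxR x) = (laxP y, laxQ y, laxR y)"
  then have *: "laxP x = laxP y" "laxQ x = laxQ y" "laxR x = laxR y" by auto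
  have "x $ i = y $ i" for i
  proof (cases i)
    case (Inl a)
    then show ?thesis using *(1) coeff_laxP(1)[of x a] coeff_laxP(1)[of y a] by simp
  next
    case (Inr b)
    then show ?thesis
      using *(2,3) coeff_laxQ(1)[of x] coeff_laxQ(1)[of y] coeff_laxR(1)[of x] coeff_laxR(1)[of y]
      by (cases b) metis+
  qed
  then show "x = y" by (simp add: vec_eq_iff)
qed

definition lax_matrix :: "('a::real_normed_field, 'g::finite) lax \<Rightarrow> 'a poly ^ 2 ^ 2" where
  "lax_matrix x = vector [vector [laxP x, laxR x], vector [laxQ x, - laxP x]]"

definition lax_F :: "('a::real_normed_field, 'g::finite) lax \<Rightarrow> 'a poly" where
  "lax_F x = laxP x ^ 2 + laxQ x * laxR x"

definition lax_c :: "nat \<Rightarrow> ('a::real_normed_field, 'g::finite) lax \<Rightarrow> 'a" where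
  "lax_c j x = coeff (lax_F x) j"

lemma lax_c_high:
  fixes x :: "('a::real_normed_field, 'g::finite) lax"
  shows "lax_c (2 * CARD('g) + 2) x = 1" "n > 2 * CARD('g) + 2 \<Longrightarrow> lax_c n x = 0"
proof -
  let ?g = "CARD('g)"
  have PP: "degree (laxP x ^ 2) = 2 * ?g + 2" "coeff (laxP x ^ 2) (2 * ?g + 2) = 1"
  proof -
    have "laxP x \<noteq> 0" using degree_laxP[of x] by auto
    then show d: "degree (laxP x ^ 2) = 2 * ?g + 2" by (simp add: degree_power_eq degree_laxP)
    show "coeff (laxP x ^ 2) (2 * ?g + 2) = 1"
      using lead_coeff_power[of "laxP x" 2] coeff_laxP(2)[of x] unfolding d degree_laxP by simp
  qed
  have QR: "degree (laxQ x * laxR x) \<le> 2 * ?g"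
    using degree_mult_le[of "laxQ x" "laxR x"] degree_laxQ[of x] degree_laxR[of x] by simp
  show "lax_c (2 * ?g + 2) x = 1"
    using PP QR by (simp add: lax_c_def lax_F_def coeff_eq_0)
  show "lax_c n x = 0" if "n > 2 * ?g + 2"
    using that PP(1) QR by (simp add: lax_c_def lax_F_def coeff_eq_0)
qed

lemma lax_F_expansion:
  fixes x :: "('a::real_normed_field, 'g::finite) lax"
  shows "lax_F x = monom 1 (2 * CARD('g) + 2) + (\<Sum>j\<le>2 * CARD('g) + 1. monom (lax_c j x) j)"
proof (rule poly_eqI)
  fix n
  consider "n \<le> 2 * CARD('g) + 1" | "n = 2 * CARD('g) + 2" | "n > 2 * CARD('g) + 2" by linarith
  then show "coeff (lax_F x) n =
      coeff (monom 1 (2 * CARD('g) + 2) + (\<Sum>j\<le>2 * CARD('g) + 1. monom (lax_c j x) j)) n"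
    using lax_c_high[where x = x] by cases (auto simp: coeff_sum lax_c_def)
qed

lemma lax_c_top:
  fixes x :: "('a::real_normed_field, 'g::finite) lax"
  shows "lax_c (2 * CARD('g) + 1) x = 2 * x $ Inl None"
proof -
  let ?g = "CARD('g)"
  have "degree (laxQ x * laxR x) \<le> 2 * ?g"
    using degree_mult_le[of "laxQ x" "laxR x"] degree_laxQ[of x] degree_laxR[of x] by simp
  then have "lax_c (2 * ?g + 1) x = coeff (laxP x * laxP x) (2 * ?g + 1)"
    by (simp add: lax_c_def lax_F_def coeff_eq_0 power2_eq_square)
  also have "\<dots> = (\<Sum>i\<le>2 * ?g + 1. coeff (laxP x) i * coeff (laxP x) (2 * ?g + 1 - i))"
    by (simp add: coeff_mult)
  also have "\<dots> = (\<Sum>i\<in>{?g, ?g + 1}. coeff (laxP x) i * coeff (laxP x) (2 * ?g + 1 - i))"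
  proof (rule sum.mono_neutral_right)
    show "\<forall>i\<in>{..2 * ?g + 1} - {?g, ?g + 1}. coeff (laxP x) i * coeff (laxP x) (2 * ?g + 1 - i) = 0"
    proof
      fix i assume "i \<in> {..2 * ?g + 1} - {?g, ?g + 1}"
      then have "i > ?g + 1 \<or> 2 * ?g + 1 - i > ?g + 1" by auto
      then show "coeff (laxP x) i * coeff (laxP x) (2 * ?g + 1 - i) = 0"
        using coeff_laxP(3)[of i x] coeff_laxP(3)[of "2 * ?g + 1 - i" x] by auto
    qed
  qed auto
  also have "\<dots> = 2 * x $ Inl None"
    using coeff_laxP(1)[of x None] coeff_laxP(2)[of x] by simp
  finally show ?thesis .
qed


subsection \<open>The Poisson bracket\<close>

text \<open>
  \<open>bivec x i j\<close> is the bracket of the \<open>i\<close>-th and \<open>j\<close>-th coordinate functions at \<open>x\<close>,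
  read off from the generating identities by means of
  \<open>(A(\<zeta>) - A(\<eta>)) / (\<zeta> - \<eta>) = (\<Sum>a b. A\<^bsub>a+b+1\<^esub> \<zeta>\<^sup>a \<eta>\<^sup>b)\<close>;
  the generating identities themselves are recovered in \<open>bracket_generating\<close> below.
\<close>

fun bivec :: "('a::real_normed_field, 'g::finite) lax \<Rightarrow> 'g coord \<Rightarrow> 'g coord \<Rightarrow> 'a" where
  "bivec x (Inl i) (Inl j) = 0"
| "bivec x (Inl i) (Inr (Inl j)) = 2 * coeff (laxQ x) (expo i + expo j + 1)"
| "bivec x (Inl i) (Inr (Inr k)) = - 2 * coeff (laxR x) (expo i + expo (Some k) + 1)"
| "bivec x (Inr (Inl i)) (Inl j) = - 2 * coeff (laxQ x) (expo i + expo j + 1)"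
| "bivec x (Inr (Inl i)) (Inr (Inl j)) =
     - 4 * ((if expo j = 0 then coeff (laxQ x) (expo i) else 0)
          - (if expo i = 0 then coeff (laxQ x) (expo j) else 0))"
| "bivec x (Inr (Inl i)) (Inr (Inr k)) =
     4 * coeff (laxP x) (expo i + expo (Some k) + 1)
     - 4 * (if expo i = 0 then coeff (laxR x) (expo (Some k)) else 0)"
| "bivec x (Inr (Inr k)) (Inl i) = 2 * coeff (laxR x) (expo i + expo (Some k) + 1)"
| "bivec x (Inr (Inr k)) (Inr (Inl i)) =
     - (4 * coeff (laxP x) (expo i + expo (Some k) + 1)
        - 4 * (if expo i = 0 then coeff (laxR x) (expo (Some k)) else 0))"
| "bivec x (Inr (Inr k)) (Inr (Inr l)) = 0"

definition partial_deriv :: "('a::real_normed_field ^ 'n::finite \<Rightarrow> 'a) \<Rightarrow> 'n \<Rightarrow> 'a ^ 'n \<Rightarrow> 'a" where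
  "partial_deriv f i x = deriv (\<lambda>t. f (x + axis i t)) 0"

definition bracket ::
  "(('a::real_normed_field, 'g::finite) lax \<Rightarrow> 'a) \<Rightarrow> (('a, 'g) lax \<Rightarrow> 'a) \<Rightarrow> ('a, 'g) lax \<Rightarrow> 'a" where
  "bracket f h x = (\<Sum>i\<in>UNIV. \<Sum>j\<in>UNIV. bivec x i j * partial_deriv f i x * partial_deriv h j x)"

lemma partial_deriv_affine:
  assumes "\<And>y. f y = c + (\<Sum>i\<in>UNIV. d i * y $ i)"
  shows "partial_deriv f i x = (d i :: 'a::real_normed_field)"
proof -
  have "f (x + axis i t) = f x + d i * t" for t
  proof -
    have "(\<Sum>j\<in>UNIV. d j * axis i t $ j) = (\<Sum>j\<in>UNIV. if j = i then d j * t else 0)"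
      by (rule sum.cong) (auto simp: axis_def)
    then show ?thesis by (simp add: assms algebra_simps sum.distrib)
  qed
  then have "((\<lambda>t. f (x + axis i t)) has_field_derivative d i) (at 0)"
    by (auto intro!: derivative_eq_intros)
  then show ?thesis unfolding partial_deriv_def by (rule DERIV_imp_deriv)
qed

lemma sum_UNIV_Plus:
  fixes h :: "'b::finite + 'c::finite \<Rightarrow> 'd::comm_monoid_add"
  shows "sum h UNIV = (\<Sum>i\<in>UNIV. h (Inl i)) + (\<Sum>i\<in>UNIV. h (Inr i))"
  unfolding UNIV_Plus_UNIV[symmetric] by (simp add: sum.Plus del: UNIV_Plus_UNIV)

lemma sum_coord:
  "(\<Sum>i\<in>(UNIV :: 'g::finite coord set). f i) =
     (\<Sum>i\<in>UNIV. f (Inl i)) + (\<Sum>i\<in>UNIV. f (Inr (Inl i))) + (\<Sum>k\<in>UNIV. f (Inr (Inr k)))"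
  by (simp add: sum_UNIV_Plus add.assoc)

lemma partial_deriv_poly_lax:
  fixes x :: "('a::real_normed_field, 'g::finite) lax"
  shows "partial_deriv (\<lambda>y. poly (laxP y) z) i x = (case i of Inl i \<Rightarrow> z ^ expo i | Inr _ \<Rightarrow> 0)"
    and "partial_deriv (\<lambda>y. poly (laxQ y) z) i x = (case i of Inr (Inl i) \<Rightarrow> z ^ expo i | _ \<Rightarrow> 0)"
    and "partial_deriv (\<lambda>y. poly (laxR y) z) i x = (case i of Inr (Inr k) \<Rightarrow> z ^ expo (Some k) | _ \<Rightarrow> 0)"
proof -
  show "partial_deriv (\<lambda>y. poly (laxP y) z) i x = (case i of Inl i \<Rightarrow> z ^ expo i | Inr _ \<Rightarrow> 0)"
    by (rule partial_deriv_affine[where c = "z ^ (CARD('g) + 1)"])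
       (simp add: laxP_def poly_sum poly_monom sum_coord mult.commute)
  show "partial_deriv (\<lambda>y. poly (laxQ y) z) i x = (case i of Inr (Inl i) \<Rightarrow> z ^ expo i | _ \<Rightarrow> 0)"
    by (rule partial_deriv_affine[where c = 0])
       (simp add: laxQ_def poly_sum poly_monom sum_coord mult.commute)
  show "partial_deriv (\<lambda>y. poly (laxR y) z) i x = (case i of Inr (Inr k) \<Rightarrow> z ^ expo (Some k) | _ \<Rightarrow> 0)"
    by (rule partial_deriv_affine[where c = "z ^ CARD('g)"])
       (simp add: laxR_def poly_sum poly_monom sum_coord mult.commute)
qed

lemma sum_divided_difference:
  fixes p :: "'a::real_normed_field poly"
  assumes "degree p \<le> m" "degree p \<le> n" "z \<noteq> w"
  shows "(\<Sum>a<m. \<Sum>b<n. coeff p (a + b + 1) * z ^ a * w ^ b) = (poly p z - poly p w) / (z - w)"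
proof -
  let ?N = "degree p"
  let ?f = "\<lambda>a b. coeff p (a + b + 1) * z ^ a * w ^ b"
  have ev: "poly p u = (\<Sum>k\<le>?N. coeff p k * u ^ k)" for u by (rule poly_altdef)
  have "poly p z - poly p w = (\<Sum>k\<le>?N. coeff p k * (z ^ k - w ^ k))"
    by (simp add: ev sum_subtractf algebra_simps)
  also have "\<dots> = (\<Sum>k\<le>?N. (z - w) * (\<Sum>a<k. coeff p k * (z ^ a * w ^ (k - Suc a))))"
    by (rule sum.cong) (simp_all add: power_diff_sumr2 sum_distrib_left mult_ac)
  also have "\<dots> = (z - w) * (\<Sum>k\<le>?N. \<Sum>a<k. coeff p k * (z ^ a * w ^ (k - Suc a)))"
    by (simp add: sum_distrib_left)
  also have "(\<Sum>k\<le>?N. \<Sum>a<k. coeff p k * (z ^ a * w ^ (k - Suc a))) =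
      (\<Sum>(k, a)\<in>(SIGMA k:{..?N}. {..<k}). coeff p k * (z ^ a * w ^ (k - Suc a)))"
    by (simp add: sum.Sigma)
  also have "\<dots> = (\<Sum>(a, b)\<in>{(a, b). a + b + 1 \<le> ?N}. ?f a b)"
    by (rule sum.reindex_bij_witness
        [where i = "\<lambda>(a, b). (a + b + 1, a)" and j = "\<lambda>(k, a). (a, k - Suc a)"])
       (auto simp: mult_ac)
  also have "\<dots> = (\<Sum>(a, b)\<in>{..<m} \<times> {..<n}. ?f a b)"
    using assms(1,2) by (intro sum.mono_neutral_left) (auto intro: le_degree)
  also have "\<dots> = (\<Sum>a<m. \<Sum>b<n. ?f a b)" by (simp add: sum.cartesian_product)
  finally show ?thesis using assms(3) by (simp add: field_simps)
qed

lemma bracket_poly: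
  fixes x :: "('a::real_normed_field, 'g::finite) lax"
  shows "bracket (\<lambda>y. poly (laxP y) z) (\<lambda>y. poly (laxP y) w) x = 0"
    and "bracket (\<lambda>y. poly (laxR y) z) (\<lambda>y. poly (laxR y) w) x = 0"
    and "bracket (\<lambda>y. poly (laxP y) z) (\<lambda>y. poly (laxQ y) w) x =
      (\<Sum>i\<in>UNIV. \<Sum>j\<in>UNIV. bivec x (Inl i) (Inr (Inl j)) * z ^ expo i * w ^ expo j)"
    and "bracket (\<lambda>y. poly (laxP y) z) (\<lambda>y. poly (laxR y) w) x =
      (\<Sum>i\<in>UNIV. \<Sum>j\<in>UNIV. bivec x (Inl i) (Inr (Inr j)) * z ^ expo i * w ^ expo (Some j))"
    and "bracket (\<lambda>y. poly (laxQ y) z) (\<lambda>y. poly (laxQ y) w) x =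
      (\<Sum>i\<in>UNIV. \<Sum>j\<in>UNIV. bivec x (Inr (Inl i)) (Inr (Inl j)) * z ^ expo i * w ^ expo j)"
    and "bracket (\<lambda>y. poly (laxQ y) z) (\<lambda>y. poly (laxR y) w) x =
      (\<Sum>i\<in>UNIV. \<Sum>j\<in>UNIV. bivec x (Inr (Inl i)) (Inr (Inr j)) * z ^ expo i * w ^ expo (Some j))"
  unfolding bracket_def partial_deriv_poly_lax by (simp_all add: sum_coord del: bivec.simps add: bivec.simps(1,9))

lemma poly_laxQ_expo:
  fixes x :: "('a::real_normed_field, 'g::finite) lax"
  shows "poly (laxQ x) z = (\<Sum>i\<in>(UNIV :: 'g option set). coeff (laxQ x) (expo i) * z ^ expo i)"
proof -
  have "poly (laxQ x) z = (\<Sum>i\<in>(UNIV :: 'g option set). x $ Inr (Inl i) * z ^ expo i)"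
    by (simp add: laxQ_def poly_sum poly_monom)
  then show ?thesis by (simp only: coeff_laxQ(1))
qed

lemma bracket_generating:
  fixes x :: "('a::real_normed_field, 'g::finite) lax"
  assumes "\<zeta> \<noteq> \<eta>"
  defines "P \<equiv> \<lambda>z (y :: ('a, 'g) lax). poly (laxP y) z"
    and "Q \<equiv> \<lambda>z (y :: ('a, 'g) lax). poly (laxQ y) z"
    and "R \<equiv> \<lambda>z (y :: ('a, 'g) lax). poly (laxR y) z"
  shows "bracket (P \<zeta>) (P \<eta>) x = 0"
    and "bracket (R \<zeta>) (R \<eta>) x = 0"
    and "bracket (P \<zeta>) (Q \<eta>) x = 2 * ((Q \<zeta> x - Q \<eta> x) / (\<zeta> - \<eta>))"
    and "bracket (P \<zeta>) (R \<eta>) x = - 2 * ((R \<zeta> x - R \<eta> x) / (\<zeta> - \<eta>))"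
    and "bracket (Q \<zeta>) (Q \<eta>) x = - 4 * (Q \<zeta> x - Q \<eta> x)"
    and "bracket (Q \<zeta>) (R \<eta>) x = 4 * ((P \<zeta> x - P \<eta> x) / (\<zeta> - \<eta>)) - 4 * R \<eta> x"
proof -
  let ?g = "CARD('g)"
  have le: "{..?g} = {..<?g + 1}" by auto
  show "bracket (P \<zeta>) (P \<eta>) x = 0" "bracket (R \<zeta>) (R \<eta>) x = 0"
    by (simp_all add: P_def R_def bracket_poly)
  have "bracket (P \<zeta>) (Q \<eta>) x =
      2 * (\<Sum>a<?g+1. \<Sum>b<?g+1. coeff (laxQ x) (a + b + 1) * \<zeta> ^ a * \<eta> ^ b)"
    unfolding P_def Q_def bracket_poly bivec.simps
    by (subst sum_expo[of "\<lambda>a. \<Sum>j\<in>UNIV. 2 * coeff (laxQ x) (a + expo j + 1) * \<zeta> ^ a * \<eta> ^ expo j"],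
        subst sum_expo[of "\<lambda>b. 2 * coeff (laxQ x) (_ + b + 1) * \<zeta> ^ _ * \<eta> ^ b"])
       (simp only: sum_distrib_left le mult.assoc)
  then show "bracket (P \<zeta>) (Q \<eta>) x = 2 * ((Q \<zeta> x - Q \<eta> x) / (\<zeta> - \<eta>))"
    by (subst (asm) sum_divided_difference) (use degree_laxQ[of x] assms(1) in \<open>simp_all add: Q_def\<close>)
  have "bracket (P \<zeta>) (R \<eta>) x =
      - 2 * (\<Sum>a<?g+1. \<Sum>b<?g. coeff (laxR x) (a + b + 1) * \<zeta> ^ a * \<eta> ^ b)"
    unfolding P_def R_def bracket_poly bivec.simps
    by (subst sum_expo[of "\<lambda>a. \<Sum>j\<in>UNIV. - 2 * coeff (laxR x) (a + expo (Some j) + 1) * \<zeta> ^ a * \<eta> ^ expo (Some j)"],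
        subst sum_expo_Some[of "\<lambda>b. - 2 * coeff (laxR x) (_ + b + 1) * \<zeta> ^ _ * \<eta> ^ b"])
       (simp only: sum_distrib_left le mult.assoc)
  then show "bracket (P \<zeta>) (R \<eta>) x = - 2 * ((R \<zeta> x - R \<eta> x) / (\<zeta> - \<eta>))"
    by (subst (asm) sum_divided_difference) (use degree_laxR[of x] assms(1) in \<open>simp_all add: R_def\<close>)
  have "0 \<in> range (expo :: 'g option \<Rightarrow> nat)"
    using bij_betw_imp_surj_on[OF bij_betw_expo[where 'g = 'g]] by simp
  then obtain i0 :: "'g option" where i0: "expo i0 = 0" by (auto simp: image_iff)
  have eq0: "expo i = 0 \<longleftrightarrow> i = i0" for i :: "'g option"
    using i0 inj_expo[of i i0] by simp
  have "bracket (Q \<zeta>) (Q \<eta>) x =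
     (\<Sum>i\<in>UNIV. \<Sum>j\<in>UNIV. (if j = i0 then - 4 * coeff (laxQ x) (expo i) * \<zeta> ^ expo i else 0)
        + (if i = i0 then 4 * coeff (laxQ x) (expo j) * \<eta> ^ expo j else 0))"
    unfolding Q_def bracket_poly bivec.simps by (intro sum.cong) (auto simp: eq0 i0 algebra_simps)
  also have "\<dots> = (\<Sum>i\<in>UNIV. - 4 * coeff (laxQ x) (expo (i :: 'g option)) * \<zeta> ^ expo i)
      + (\<Sum>j\<in>UNIV. 4 * coeff (laxQ x) (expo (j :: 'g option)) * \<eta> ^ expo j)"
    unfolding sum.distrib by (rule arg_cong2[where f = "(+)"]) (simp, subst sum.swap, simp)
  also have "\<dots> = - 4 * (Q \<zeta> x - Q \<eta> x)"
    unfolding Q_def poly_laxQ_expo right_diff_distrib sum_distrib_left mult.assoc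
    by (simp add: sum_negf)
  finally show "bracket (Q \<zeta>) (Q \<eta>) x = - 4 * (Q \<zeta> x - Q \<eta> x)" .
  show "bracket (Q \<zeta>) (R \<eta>) x = 4 * ((P \<zeta> x - P \<eta> x) / (\<zeta> - \<eta>)) - 4 * R \<eta> x"
  proof -
    have "bracket (Q \<zeta>) (R \<eta>) x =
      (\<Sum>i\<in>UNIV. \<Sum>k\<in>UNIV. 4 * coeff (laxP x) (expo (i :: 'g option) + expo (Some (k :: 'g)) + 1) * \<zeta> ^ expo i * \<eta> ^ expo (Some k))
      - (\<Sum>i\<in>UNIV. \<Sum>k\<in>UNIV. if i = i0 then 4 * coeff (laxR x) (expo (Some (k :: 'g))) * \<eta> ^ expo (Some k) else 0)"
      (is "_ = ?A - ?B")
      unfolding Q_def R_def bracket_poly bivec.simps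
      by (simp only: flip: sum_subtractf) (intro sum.cong refl, auto simp: eq0 i0 algebra_simps)
    also have "?A = 4 * (\<Sum>a<?g+1. \<Sum>b<?g. coeff (laxP x) (a + b + 1) * \<zeta> ^ a * \<eta> ^ b)"
      by (subst sum_expo[of "\<lambda>a. \<Sum>j\<in>UNIV. 4 * coeff (laxP x) (a + expo (Some j) + 1) * \<zeta> ^ a * \<eta> ^ expo (Some j)"],
          subst sum_expo_Some[of "\<lambda>b. 4 * coeff (laxP x) (_ + b + 1) * \<zeta> ^ _ * \<eta> ^ b"])
         (simp only: sum_distrib_left le mult.assoc)
    also have "(\<Sum>a<?g+1. \<Sum>b<?g. coeff (laxP x) (a + b + 1) * \<zeta> ^ a * \<eta> ^ b) =
        (P \<zeta> x - P \<eta> x) / (\<zeta> - \<eta>) - \<eta> ^ ?g"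
    proof -
      have "(\<Sum>a<?g+1. \<Sum>b<?g+1. coeff (laxP x) (a + b + 1) * \<zeta> ^ a * \<eta> ^ b) =
          (\<Sum>a<?g+1. \<Sum>b<?g. coeff (laxP x) (a + b + 1) * \<zeta> ^ a * \<eta> ^ b)
          + (\<Sum>a<?g+1. coeff (laxP x) (a + ?g + 1) * \<zeta> ^ a * \<eta> ^ ?g)"
        unfolding sum.distrib[symmetric] by simp
      also have "(\<Sum>a<?g+1. coeff (laxP x) (a + ?g + 1) * \<zeta> ^ a * \<eta> ^ ?g) =
          (\<Sum>a\<in>{0}. coeff (laxP x) (a + ?g + 1) * \<zeta> ^ a * \<eta> ^ ?g)"
        by (rule sum.mono_neutral_right) (auto simp: coeff_laxP(3))
      also have "\<dots> = \<eta> ^ ?g"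
        using coeff_laxP(2)[of x] by simp
      finally show ?thesis
        by (subst (asm) sum_divided_difference)
           (use degree_laxP[of x] assms(1) in \<open>simp_all add: P_def algebra_simps\<close>)
    qed
    also have "?B = 4 * (R \<eta> x - \<eta> ^ ?g)"
    proof -
      have "?B = (\<Sum>k\<in>UNIV. 4 * coeff (laxR x) (expo (Some (k :: 'g))) * \<eta> ^ expo (Some k))"
        by (subst sum.swap) simp
      moreover have "R \<eta> x = \<eta> ^ ?g + (\<Sum>k\<in>UNIV. x $ Inr (Inr k) * \<eta> ^ expo (Some (k :: 'g)))"
        by (simp add: R_def laxR_def poly_sum poly_monom)
      ultimately show ?thesis
        by (simp add: coeff_laxR(1) sum_distrib_left mult.assoc)
    qed
    finally show ?thesis by (simp add: algebra_simps)
  qed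
qed

text \<open>
  Frechet differentiability with a derivative that is linear over the ground field
  (over the complex numbers, the derivative must be complex-linear).
\<close>

definition diff_at :: "('a::real_normed_field ^ 'n::finite \<Rightarrow> 'a) \<Rightarrow> 'a ^ 'n \<Rightarrow> bool" where
  "diff_at f x \<longleftrightarrow> (\<exists>d :: 'a ^ 'n. (f has_derivative (\<lambda>v. \<Sum>i\<in>UNIV. d $ i * v $ i)) (at x))"

definition casimir :: "(('a::real_normed_field, 'g::finite) lax \<Rightarrow> 'a) \<Rightarrow> bool" where
  "casimir f \<longleftrightarrow> (\<forall>x. diff_at f x) \<and> (\<forall>h x. diff_at h x \<longrightarrow> bracket f h x = 0)"


subsection \<open>The level set of the Casimir of highest index\<close>

definition level_set :: "('a::real_normed_field, 'g::finite) lax set" where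
  "level_set = {x. lax_c (2 * CARD('g) + 1) x = 0}"

lemma level_set_iff: "x \<in> level_set \<longleftrightarrow> x $ Inl None = 0"
  by (simp add: level_set_def lax_c_top[simplified])

text \<open>
  The level set is the hyperplane where the coefficient of \<open>\<zeta>\<^sup>g\<close> in \<open>P\<close> vanishes (see
  \<open>level_set_iff\<close>). A function \<open>f\<close> on it is treated through its extension \<open>f \<circ> to_level\<close>;
  only the values of \<open>f\<close> on the level set enter the notions with prefix \<open>l\<close>. Since
  the level function is a Casimir, the bracket does not depend on the extension chosen.
\<close>

definition to_level :: "('a::real_normed_field, 'g::finite) lax \<Rightarrow> ('a, 'g) lax" where
  "to_level x = (\<chi> i. if i = Inl None then 0 else x $ i)"

definition lbracket ::
  "(('a::real_normed_field, 'g::finite) lax \<Rightarrow> 'a) \<Rightarrow> (('a, 'g) lax \<Rightarrow> 'a) \<Rightarrow> ('a, 'g) lax \<Rightarrow> 'a" where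
  "lbracket f h x = bracket (f \<circ> to_level) (h \<circ> to_level) x"

lemma lbracket_eq_bracket:
  fixes x :: "('a::real_normed_field, 'g::finite) lax"
  assumes "x \<in> level_set"
  shows "lbracket f h x = bracket f h x"
proof -
  have [simp]: "coeff (laxQ x) (Suc (CARD('g) + n)) = 0" "coeff (laxQ x) (Suc (n + CARD('g))) = 0"
    "coeff (laxR x) (Suc (CARD('g) + n)) = 0" for n
    by (simp_all add: coeff_laxQ(2) coeff_laxR(3))
  have biv: "bivec x (Inl None) j = 0" "bivec x j (Inl None) = 0" for j
    by (cases "(x, Inl None :: 'g coord, j)" rule: bivec.cases; simp)
       (cases "(x, j, Inl None :: 'g coord)" rule: bivec.cases; simp)
  have pd: "partial_deriv (f \<circ> to_level) i x = partial_deriv f i x" if "i \<noteq> Inl None"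
    for f :: "('a, 'g) lax \<Rightarrow> 'a" and i
  proof -
    have "to_level (x + axis i t) = x + axis i t" for t
      using assms that by (auto simp: to_level_def vec_eq_iff level_set_iff axis_def)
    then show ?thesis by (simp add: partial_deriv_def)
  qed
  show ?thesis
    unfolding lbracket_def bracket_def
  proof (intro sum.cong refl)
    fix i j
    show "bivec x i j * partial_deriv (f \<circ> to_level) i x * partial_deriv (h \<circ> to_level) j x =
        bivec x i j * partial_deriv f i x * partial_deriv h j x"
      using biv by (cases "i = Inl None \<or> j = Inl None") (auto simp: pd)
  qed
qed

definition ldiff_at :: "(('a::real_normed_field, 'g::finite) lax \<Rightarrow> 'a) \<Rightarrow> ('a, 'g) lax \<Rightarrow> bool" where
  "ldiff_at f x \<longleftrightarrow> diff_at (f \<circ> to_level) x"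

definition ldifferential ::
  "(('a::real_normed_field, 'g::finite) lax \<Rightarrow> 'a) \<Rightarrow> ('a, 'g) lax \<Rightarrow> ('a, 'g) lax \<Rightarrow> 'a" where
  "ldifferential f x v = (\<Sum>i\<in>UNIV. partial_deriv (f \<circ> to_level) i x * v $ i)"

text \<open>The tangent space at \<open>x\<close> of the symplectic leaf through \<open>x\<close>: all Hamiltonian vectors at \<open>x\<close>.\<close>

definition leaf_tangent :: "('a::real_normed_field, 'g::finite) lax \<Rightarrow> ('a, 'g) lax set" where
  "leaf_tangent x = range (\<lambda>\<alpha> :: ('a, 'g) lax. \<chi> i. \<Sum>j\<in>UNIV. bivec x i j * \<alpha> $ j)"

definition poisson_map_on ::
  "('a::real_normed_field, 'g::finite) lax set \<Rightarrow> (('a, 'g) lax \<Rightarrow> ('a, 'g) lax) \<Rightarrow> bool" where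
  "poisson_map_on U \<Phi> \<longleftrightarrow>
     (\<forall>x\<in>U. \<Phi> x \<in> level_set) \<and>
     (\<forall>x\<in>U. \<forall>f. ldiff_at f (\<Phi> x) \<longrightarrow> ldiff_at (f \<circ> \<Phi>) x) \<and>
     (\<forall>x\<in>U. \<forall>f h. ldiff_at f (\<Phi> x) \<longrightarrow> ldiff_at h (\<Phi> x) \<longrightarrow>
        lbracket (f \<circ> \<Phi>) (h \<circ> \<Phi>) x = lbracket f h (\<Phi> x))"

definition in_involution :: "nat \<Rightarrow> (nat \<Rightarrow> ('a::real_normed_field, 'g::finite) lax \<Rightarrow> 'a) \<Rightarrow> bool" where
  "in_involution n H \<longleftrightarrow>
     (\<forall>j<n. \<forall>x\<in>level_set. ldiff_at (H j) x) \<and>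
     (\<forall>j<n. \<forall>k<n. \<forall>x\<in>level_set. lbracket (H j) (H k) x = 0)"

text \<open>
  On an open dense part of the level set the symplectic leaves have dimension \<open>2n\<close> and the
  restrictions to them of \<open>H 0, \<dots>, H (n - 1)\<close> have linearly independent differentials;
  \<open>n\<close> functions in involution are then as many as possible.
\<close>

definition maximal_independent ::
  "nat \<Rightarrow> (nat \<Rightarrow> ('a::real_normed_field, 'g::finite) lax \<Rightarrow> 'a) \<Rightarrow> bool" where
  "maximal_independent n H \<longleftrightarrow>
     (\<exists>W. openin (top_of_set level_set) W \<and> level_set \<subseteq> closure W \<and>
        (\<forall>x\<in>W. vec.dim (leaf_tangent x) = 2 * n \<and>
           (\<forall>a :: nat \<Rightarrow> 'a. (\<forall>v\<in>leaf_tangent x. (\<Sum>j<n. a j * ldifferential (H j) x v) = 0)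
              \<longrightarrow> (\<forall>j<n. a j = 0))))"

definition integrable_poisson_map_on ::
  "('a::real_normed_field, 'g::finite) lax set \<Rightarrow> (('a, 'g) lax \<Rightarrow> ('a, 'g) lax) \<Rightarrow>
   nat \<Rightarrow> (nat \<Rightarrow> ('a, 'g) lax \<Rightarrow> 'a) \<Rightarrow> bool" where
  "integrable_poisson_map_on U \<Phi> n H \<longleftrightarrow>
     poisson_map_on U \<Phi> \<and>
     (\<forall>j<n. \<forall>x\<in>U. H j (\<Phi> x) = H j x) \<and>
     in_involution n H \<and> maximal_independent n H"


subsection \<open>The map\<close>

text \<open>Determined by \<open>Q = - 4 d\<^sub>0 (\<zeta>\<^sup>g - v\<^sub>0 \<zeta>\<^bsup>g-1\<^esup> + O(\<zeta>\<^bsup>g-2\<^esup>))\<close>.\<close>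

definition lax_d0 :: "('a::real_normed_field, 'g::finite) lax \<Rightarrow> 'a" where
  "lax_d0 x = - coeff (laxQ x) CARD('g) / 4"

definition lax_v0 :: "('a::real_normed_field, 'g::finite) lax \<Rightarrow> 'a" where
  "lax_v0 x = coeff (laxQ x) (CARD('g) - 1) / (4 * lax_d0 x)"

lemma laxQ_leading:
  fixes x :: "('a::real_normed_field, 'g::finite) lax"
  assumes "lax_d0 x \<noteq> 0"
  shows "coeff (laxQ x) CARD('g) = - 4 * lax_d0 x"
    and "coeff (laxQ x) (CARD('g) - 1) = 4 * lax_d0 x * lax_v0 x"
  using assms by (simp_all add: lax_v0_def lax_d0_def)

definition lax_domain :: "('a::real_normed_field, 'g::finite) lax set" where
  "lax_domain = {x \<in> level_set. lax_d0 x \<noteq> 0}"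

definition lax_step :: "('a::real_normed_field, 'g::finite) lax \<Rightarrow> ('a, 'g) lax \<Rightarrow> bool" where
  "lax_step x y \<longleftrightarrow>
     [:lax_v0 x, 1:] * (laxP y - laxP x) = - smult (2 * lax_d0 x) (laxR x) - smult (1/2) (laxQ y) \<and>
     smult (2 * lax_d0 x) (laxP y + laxP x) = - ([:lax_v0 x, 1:] * laxQ x) \<and>
     smult (- 4 * lax_d0 x) (laxR y) = laxQ x"

definition lax_map :: "('a::real_normed_field, 'g::finite) lax \<Rightarrow> ('a, 'g) lax" where
  "lax_map x = (THE y. lax_step x y)"

definition lax_M :: "('a::real_normed_field, 'g::finite) lax \<Rightarrow> 'a poly ^ 2 ^ 2" where
  "lax_M x = vector [vector [[:lax_v0 x, 1:], [:1/2:]], vector [[:- 2 * lax_d0 x:], 0]]"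

end

theory Submission
  imports Defs
begin

text \<open>
  The whole argument is carried out with generating functions. Writing \<open>a\<close> and \<open>b\<close> for the two leading
  coefficients of \<open>Q\<close> and \<open>v = - b / a\<close>, the new matrix is \<open>R' = Q / a\<close>, \<open>P' = 2 (\<zeta> + v) R' - P\<close>,
  \<open>Q' = a R - 2 (\<zeta> + v) (P' - P)\<close>. The brackets of \<open>a\<close> and \<open>v\<close> with \<open>P\<close>, \<open>Q\<close>, \<open>R\<close> are read off from
  the generating identities, and the identities for \<open>P'\<close>, \<open>Q'\<close>, \<open>R'\<close> follow by algebra; the chain
  rule then gives the Poisson property. Conservation of \<open>F\<close> is conjugation by \<open>M\<close>.

  The bracket of \<open>F(\<zeta>)\<close> with \<open>P(\<eta>)\<close>, \<open>Q(\<eta>)\<close>, \<open>R(\<eta>)\<close> is a polynomial of degree less than \<open>g\<close> in \<open>\<zeta>\<close>, so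
  \<open>c\<^sub>j\<close> is a Casimir for \<open>j \<ge> g\<close>, and \<open>{F(\<zeta>), F(\<eta>)} = 0\<close>. The rank of the bivector is \<open>2 g\<close> everywhere:
  the rows of \<open>P\<close> and \<open>R\<close> are independent since their pairing is an antitriangular Hankel matrix, and the
  Casimirs express the rows of \<open>Q\<close> through them. Finally the matrix of the brackets of \<open>c\<^sub>0, \<dots>, c\<^bsub>g-1\<^esub>\<close> with the
  coefficients of \<open>P\<close> is (twice) the Bezout matrix of \<open>R\<close> and \<open>Q\<close>. Adding a constant \<open>t\<close> to \<open>Q\<close> adds to
  it \<open>t\<close> times an invertible Hankel matrix, so it is invertible on an open dense set.
\<close>

subsection \<open>Gradients\<close>

definition has_grad :: "('a::real_normed_field ^ 'n::finite \<Rightarrow> 'a) \<Rightarrow> 'a ^ 'n \<Rightarrow> 'a ^ 'n \<Rightarrow> bool" where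
  "has_grad f d x \<longleftrightarrow> (f has_derivative (\<lambda>v. \<Sum>i\<in>UNIV. d $ i * v $ i)) (at x)"

lemma diff_at_iff_has_grad: "diff_at f x \<longleftrightarrow> (\<exists>d. has_grad f d x)"
  by (simp add: diff_at_def has_grad_def)

lemma norm_axis: "norm (axis i t :: 'a::real_normed_field ^ 'n::finite) = norm t"
proof -
  have "axis i t = (\<chi> j. if j = i then t else 0)" by (simp add: axis_def)
  moreover have "(\<Sum>j\<in>UNIV. (norm (if j = i then t else 0))\<^sup>2) = (norm t)\<^sup>2"
    by (subst sum.cong[OF refl, of _ _ "\<lambda>j. if j = i then (norm t)\<^sup>2 else 0"]) auto
  ultimately show ?thesis by (simp add: norm_vec_def L2_set_def)
qed

lemma bounded_linear_axis:
  "bounded_linear (axis i :: 'a::real_normed_field \<Rightarrow> 'a ^ 'n::finite)"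
  by (rule bounded_linear_intro[where K = 1]) (auto simp: axis_def vec_eq_iff norm_axis[unfolded axis_def])

text \<open>Chain rule along the line \<open>t \<mapsto> x + axis i t\<close>. It makes gradients
  unique and lets \<open>bracket\<close>, which is built from partial derivatives, be evaluated on
  any gradient found by rules.\<close>

lemma has_grad_imp_partial_deriv:
  assumes "has_grad f d x"
  shows "partial_deriv f i x = d $ i"
proof -
  have ax: "((\<lambda>t. x + axis i t) has_derivative axis i) (at 0)"
    using bounded_linear.has_derivative[OF bounded_linear_axis has_derivative_ident]
    by (auto intro!: derivative_eq_intros)
  have "axis i (0::'a) = (0 :: 'a ^ 'b)" by (simp add: axis_def vec_eq_iff)
  then have "(f has_derivative (\<lambda>v. \<Sum>i\<in>UNIV. d $ i * v $ i)) (at (x + axis i 0))"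
    using assms by (simp only: has_grad_def add_0_right)
  from has_derivative_compose[OF ax this]
  have "((\<lambda>t. f (x + axis i t)) has_derivative (\<lambda>t. \<Sum>j\<in>UNIV. d $ j * axis i t $ j)) (at 0)" .
  moreover have "(\<Sum>j\<in>UNIV. d $ j * axis i t $ j) = d $ i * t" for t
    by (subst sum.cong[OF refl, of _ _ "\<lambda>j. if j = i then d $ j * t else 0"]) (auto simp: axis_def)
  ultimately have "((\<lambda>t. f (x + axis i t)) has_field_derivative d $ i) (at 0)"
    by (simp add: has_field_derivative_def)
  then show ?thesis unfolding partial_deriv_def by (rule DERIV_imp_deriv)
qed

lemma has_grad_unique: "has_grad f d x \<Longrightarrow> has_grad f e x \<Longrightarrow> d = e"
  using has_grad_imp_partial_deriv[of f d x] has_grad_imp_partial_deriv[of f e x]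
  by (simp add: vec_eq_iff)

lemma has_grad_const: "has_grad (\<lambda>_. c) 0 x"
  by (simp add: has_grad_def)

lemma has_grad_nth: "has_grad (\<lambda>y. y $ i) (axis i 1) x"
proof -
  have eq: "(\<lambda>v. \<Sum>j\<in>UNIV. axis i 1 $ j * v $ j) = (\<lambda>v :: 'a ^ 'b. v $ i)"
    by (rule ext, subst sum.cong[OF refl, of _ _ "\<lambda>j. if j = i then _ $ j else 0"]) (auto simp: axis_def)
  show ?thesis unfolding has_grad_def eq
    by (rule bounded_linear.has_derivative[OF bounded_linear_vec_nth has_derivative_ident])
qed

lemma has_grad_add: "has_grad f d x \<Longrightarrow> has_grad h e x \<Longrightarrow> has_grad (\<lambda>y. f y + h y) (d + e) x"
  unfolding has_grad_def
  by (drule (1) has_derivative_add) (simp add: sum.distrib[symmetric] distrib_right)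

lemma has_grad_mult:
  "has_grad f d x \<Longrightarrow> has_grad h e x \<Longrightarrow> has_grad (\<lambda>y. f y * h y) (f x *s e + h x *s d) x"
  unfolding has_grad_def
  by (drule (1) has_derivative_mult)
     (simp add: sum.distrib[symmetric] sum_distrib_left sum_distrib_right distrib_left mult_ac)

lemma has_grad_cmult: "has_grad f d x \<Longrightarrow> has_grad (\<lambda>y. c * f y) (c *s d) x"
  using has_grad_mult[OF has_grad_const, of f d x c] by simp

lemma has_grad_sum:
  "(\<And>k. k \<in> S \<Longrightarrow> has_grad (f k) (d k) x) \<Longrightarrow> has_grad (\<lambda>y. \<Sum>k\<in>S. f k y) (\<Sum>k\<in>S. d k) x"
  by (induction S rule: infinite_finite_induct) (auto intro: has_grad_const has_grad_add)

lemma has_grad_inverse: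
  assumes "has_grad f d x" "f x \<noteq> 0"
  shows "has_grad (\<lambda>y. inverse (f y)) ((- (inverse (f x))\<^sup>2) *s d) x"
proof -
  have "((\<lambda>y. inverse (f y)) has_derivative
      (\<lambda>h. - (inverse (f x) * (\<Sum>i\<in>UNIV. d $ i * h $ i) * inverse (f x)))) (at x)"
    using assms by (intro Deriv.has_derivative_inverse) (auto simp: has_grad_def)
  then show ?thesis
    unfolding has_grad_def
    by (simp add: sum_distrib_left sum_distrib_right sum_negf[symmetric] power2_eq_square mult_ac)
qed

text \<open>Needed because \<open>lax_map\<close> is given by explicit formulas only on
  \<open>lax_domain\<close>: the functions compared later coincide merely near the point of
  differentiation.\<close>

lemma has_grad_transform_eventually:
  assumes "has_grad f d x" "\<forall>\<^sub>F y in nhds x. f y = h y"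
  shows "has_grad h d x"
proof -
  have "f x = h x" using assms(2) by (rule eventually_nhds_x_imp_x)
  moreover have "\<forall>\<^sub>F y in at x. f y = h y"
    using assms(2) by (simp add: eventually_at_filter eventually_mono)
  ultimately show ?thesis
    using assms(1) unfolding has_grad_def by (auto intro: has_derivative_transform_eventually)
qed

text \<open>The map is the sum of its components carried into the coordinate axes, and each
  embedding \<open>axis k\<close> is bounded linear.\<close>

lemma has_derivative_vec:
  fixes f :: "'a::real_normed_field ^ 'm::finite \<Rightarrow> 'a ^ 'n::finite"
  assumes "\<And>k. has_grad (\<lambda>y. f y $ k) (d k) x"
  shows "(f has_derivative (\<lambda>v. \<chi> k. \<Sum>i\<in>UNIV. d k $ i * v $ i)) (at x)"
proof -
  have eq: "w = (\<Sum>k\<in>UNIV. axis k (w $ k))" for w :: "'a ^ 'n"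
    by (simp add: vec_eq_iff axis_def)
  have "((\<lambda>y. \<Sum>k\<in>UNIV. axis k (f y $ k) :: 'a ^ 'n) has_derivative
      (\<lambda>v. \<Sum>k\<in>UNIV. axis k (\<Sum>i\<in>UNIV. d k $ i * v $ i))) (at x)"
    using assms unfolding has_grad_def
    by (intro has_derivative_sum bounded_linear.has_derivative[OF bounded_linear_axis]) auto
  moreover have "(\<lambda>y. \<Sum>k\<in>UNIV. axis k (f y $ k) :: 'a ^ 'n) = f"
    by (simp add: eq[symmetric])
  moreover have "(\<lambda>v. \<Sum>k\<in>UNIV. axis k (\<Sum>i\<in>UNIV. d k $ i * v $ i)) =
      (\<lambda>v. \<chi> k. \<Sum>i\<in>UNIV. d k $ i * v $ i)"
    by (auto simp: vec_eq_iff axis_def)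
  ultimately show ?thesis by simp
qed

lemma has_grad_compose:
  fixes f :: "'a::real_normed_field ^ 'm::finite \<Rightarrow> 'a ^ 'n::finite"
  assumes f: "\<And>k. has_grad (\<lambda>y. f y $ k) (d k) x" and h: "has_grad h e (f x)"
  shows "has_grad (\<lambda>y. h (f y)) (\<Sum>k\<in>UNIV. e $ k *s d k) x"
proof -
  have "((\<lambda>y. h (f y)) has_derivative
      (\<lambda>v. \<Sum>k\<in>UNIV. e $ k * (\<chi> k. \<Sum>i\<in>UNIV. d k $ i * v $ i) $ k)) (at x)"
    using h unfolding has_grad_def by (intro has_derivative_compose[OF has_derivative_vec[OF f]])
  moreover have "(\<Sum>k\<in>UNIV. e $ k * (\<chi> k. \<Sum>i\<in>UNIV. d k $ i * v $ i) $ k) =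
      (\<Sum>i\<in>UNIV. (\<Sum>k\<in>UNIV. e $ k *s d k) $ i * v $ i)" for v
    by (simp add: sum_distrib_left sum_distrib_right mult_ac) (rule sum.swap)
  ultimately show ?thesis by (simp add: has_grad_def)
qed

section \<open>Coefficientwise gradients of polynomial-valued maps\<close>

definition has_pgrad ::
  "('a::real_normed_field ^ 'n::finite \<Rightarrow> 'a poly) \<Rightarrow> ('n \<Rightarrow> 'a poly) \<Rightarrow> 'a ^ 'n \<Rightarrow> bool" where
  "has_pgrad p D x \<longleftrightarrow> (\<forall>n. has_grad (\<lambda>y. coeff (p y) n) (\<chi> i. coeff (D i) n) x)"

lemma has_pgrad_const: "has_pgrad (\<lambda>_. p) (\<lambda>_. 0) x"
  unfolding has_pgrad_def coeff_0 zero_vec_def[symmetric] by (blast intro: has_grad_const)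

lemma has_pgrad_add:
  assumes "has_pgrad p D x" "has_pgrad q E x"
  shows "has_pgrad (\<lambda>y. p y + q y) (\<lambda>i. D i + E i) x"
  unfolding has_pgrad_def
proof
  fix n
  have "(\<chi> i. coeff (D i + E i) n) = (\<chi> i. coeff (D i) n) + (\<chi> i. coeff (E i) n)"
    by (simp add: vec_eq_iff)
  then show "has_grad (\<lambda>y. coeff (p y + q y) n) (\<chi> i. coeff (D i + E i) n) x"
    using has_grad_add assms by (fastforce simp: has_pgrad_def)
qed

text \<open>Leibniz rule for the convolution of coefficients. Proved once here, it allows all later
  differentiation to be done with whole polynomials.\<close>

lemma has_pgrad_mult:
  assumes "has_pgrad p D x" "has_pgrad q E x"
  shows "has_pgrad (\<lambda>y. p y * q y) (\<lambda>i. p x * E i + D i * q x) x"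
  unfolding has_pgrad_def
proof
  fix n
  have eq: "(\<chi> i. coeff (p x * E i + D i * q x) n) =
      (\<Sum>k\<le>n. coeff (p x) k *s (\<chi> i. coeff (E i) (n - k)) + coeff (q x) (n - k) *s (\<chi> i. coeff (D i) k))"
    by (simp add: vec_eq_iff coeff_mult sum.distrib mult.commute[of "coeff (q x) _"])
  show "has_grad (\<lambda>y. coeff (p y * q y) n) (\<chi> i. coeff (p x * E i + D i * q x) n) x"
    unfolding eq coeff_mult using assms
    by (intro has_grad_sum has_grad_mult) (auto simp: has_pgrad_def)
qed

lemma has_pgrad_uminus: "has_pgrad p D x \<Longrightarrow> has_pgrad (\<lambda>y. - p y) (\<lambda>i. - D i) x"
  using has_pgrad_mult[OF has_pgrad_const, of p D x "- 1"] by simp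

lemma has_pgrad_diff:
  assumes "has_pgrad p D x" "has_pgrad q E x"
  shows "has_pgrad (\<lambda>y. p y - q y) (\<lambda>i. D i - E i) x"
  using has_pgrad_add[OF assms(1) has_pgrad_uminus[OF assms(2)]] by simp

lemma has_pgrad_pCons_const: "has_grad f d x \<Longrightarrow> has_pgrad (\<lambda>y. [:f y:]) (\<lambda>i. [:d $ i:]) x"
  unfolding has_pgrad_def
proof
  fix n assume "has_grad f d x"
  then show "has_grad (\<lambda>y. coeff [:f y:] n) (\<chi> i. coeff [:d $ i:] n) x"
    using has_grad_const[of 0 x] by (cases n) (simp_all add: zero_vec_def)
qed

lemma has_pgrad_transform_eventually:
  assumes "has_pgrad p D x" "\<forall>\<^sub>F y in nhds x. p y = q y"
  shows "has_pgrad q D x"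
  using assms(1) has_grad_transform_eventually[OF _ eventually_mono[OF assms(2)]]
  unfolding has_pgrad_def by metis

text \<open>Identities carrying a factor \<open>z - w\<close> say nothing at \<open>z = w\<close>.
  The missing point is harmless for polynomials, since a field of characteristic zero is
  infinite.\<close>

lemma poly_eq_0_cofinite:
  fixes p :: "'a::real_normed_field poly"
  assumes "finite Z" "\<And>z. z \<notin> Z \<Longrightarrow> poly p z = 0"
  shows "p = 0"
proof (rule ccontr)
  assume "p \<noteq> 0"
  then have "finite ({z. poly p z = 0} \<union> Z)" using assms(1) by (simp add: poly_roots_finite)
  moreover have "{z. poly p z = 0} \<union> Z = UNIV" using assms(2) by auto
  ultimately show False using infinite_UNIV_char_0[where 'a = 'a] by simp
qed

subsection \<open>The bracket on covectors\<close>

lemma bivec_antisym: "bivec x i j = - bivec x j i"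
  by (cases "(x, i, j)" rule: bivec.cases) (simp_all add: add.commute)

text \<open>The bivector as a bilinear form on covectors, so that bilinearity and antisymmetry hold
  without differentiability conditions.\<close>

definition pb :: "('a::real_normed_field, 'g::finite) lax \<Rightarrow> ('a, 'g) lax \<Rightarrow> ('a, 'g) lax \<Rightarrow> 'a" where
  "pb x \<alpha> \<beta> = (\<Sum>i\<in>UNIV. \<Sum>j\<in>UNIV. bivec x i j * \<alpha> $ i * \<beta> $ j)"

lemma bracket_eq_pb: "has_grad f \<alpha> x \<Longrightarrow> has_grad h \<beta> x \<Longrightarrow> bracket f h x = pb x \<alpha> \<beta>"
  by (simp add: bracket_def pb_def has_grad_imp_partial_deriv)

lemma pb_antisym: "pb x \<alpha> \<beta> = - pb x \<beta> \<alpha>"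
proof -
  have "pb x \<alpha> \<beta> = (\<Sum>j\<in>UNIV. \<Sum>i\<in>UNIV. bivec x i j * \<alpha> $ i * \<beta> $ j)"
    unfolding pb_def by (rule sum.swap)
  also have "\<dots> = (\<Sum>j\<in>UNIV. \<Sum>i\<in>UNIV. - (bivec x j i * \<beta> $ j * \<alpha> $ i))"
    by (intro sum.cong refl, subst bivec_antisym) simp
  finally show ?thesis by (simp add: pb_def sum_negf)
qed

lemma pb_left_linear:
  "pb x (\<alpha> + \<alpha>') \<beta> = pb x \<alpha> \<beta> + pb x \<alpha>' \<beta>" "pb x (\<alpha> - \<alpha>') \<beta> = pb x \<alpha> \<beta> - pb x \<alpha>' \<beta>"
  "pb x (- \<alpha>) \<beta> = - pb x \<alpha> \<beta>" "pb x (c *s \<alpha>) \<beta> = c * pb x \<alpha> \<beta>" "pb x 0 \<beta> = 0"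
  by (simp_all add: pb_def algebra_simps sum.distrib sum_subtractf sum_negf sum_distrib_left)

lemma pb_right_linear:
  "pb x \<alpha> (\<beta> + \<beta>') = pb x \<alpha> \<beta> + pb x \<alpha> \<beta>'" "pb x \<alpha> (\<beta> - \<beta>') = pb x \<alpha> \<beta> - pb x \<alpha> \<beta>'"
  "pb x \<alpha> (- \<beta>) = - pb x \<alpha> \<beta>" "pb x \<alpha> (c *s \<beta>) = c * pb x \<alpha> \<beta>" "pb x \<alpha> 0 = 0"
  by (simp_all add: pb_def algebra_simps sum.distrib sum_subtractf sum_negf sum_distrib_left)

lemmas pb_linear = pb_left_linear pb_right_linear

lemma pb_sum_left: "pb x (\<Sum>k\<in>S. f k) \<beta> = (\<Sum>k\<in>S. pb x (f k) \<beta>)"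
  by (induction S rule: infinite_finite_induct) (simp_all add: pb_linear)

lemma pb_sum_right: "pb x \<alpha> (\<Sum>k\<in>S. f k) = (\<Sum>k\<in>S. pb x \<alpha> (f k))"
  by (induction S rule: infinite_finite_induct) (simp_all add: pb_linear)

lemma pb_axis_right: "pb x \<alpha> (axis k 1) = (\<Sum>i\<in>UNIV. bivec x i k * \<alpha> $ i)"
proof -
  have "(\<Sum>j\<in>UNIV. bivec x i j * \<alpha> $ i * axis k 1 $ j) = bivec x i k * \<alpha> $ i" for i
    by (subst sum.cong[OF refl, of _ _ "\<lambda>j. if j = k then bivec x i j * \<alpha> $ i else 0"]) (auto simp: axis_def)
  then show ?thesis by (simp add: pb_def)
qed

lemma vec_eq_sum_axis: "\<alpha> = (\<Sum>k\<in>UNIV. \<alpha> $ k *s (axis k 1 :: 'a::real_normed_field ^ 'n::finite))"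
proof -
  have "\<alpha> $ i = (\<Sum>k\<in>UNIV. \<alpha> $ k * axis k 1 $ i)" for i
    by (subst sum.cong[OF refl, of _ _ "\<lambda>k. if k = i then \<alpha> $ k else 0"]) (auto simp: axis_def)
  then show ?thesis unfolding vec_eq_iff sum_component vector_smult_component by (rule allI)
qed

lemma pb_axis_axis: "pb x (axis i 1) (axis j 1) = bivec x i j"
  unfolding pb_axis_right
  by (subst sum.cong[OF refl, of _ _ "\<lambda>k. if k = i then bivec x k j else 0"]) (auto simp: axis_def)

lemma pb_expand: "pb x \<alpha> \<beta> = (\<Sum>k\<in>UNIV. \<beta> $ k * pb x \<alpha> (axis k 1))"
  by (subst vec_eq_sum_axis[of \<beta>]) (simp only: pb_sum_right pb_linear)

section \<open>Covectors of the evaluations of P, Q and R\<close>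

definition dP :: "'g::finite coord \<Rightarrow> 'a::real_normed_field poly" where
  "dP i = (case i of Inl i \<Rightarrow> monom 1 (expo i) | Inr _ \<Rightarrow> 0)"

definition dQ :: "'g::finite coord \<Rightarrow> 'a::real_normed_field poly" where
  "dQ i = (case i of Inr (Inl i) \<Rightarrow> monom 1 (expo i) | _ \<Rightarrow> 0)"

definition dR :: "'g::finite coord \<Rightarrow> 'a::real_normed_field poly" where
  "dR i = (case i of Inr (Inr k) \<Rightarrow> monom 1 (expo (Some k)) | _ \<Rightarrow> 0)"

lemma dPQR_simps [simp]:
  "dP (Inl i) = monom 1 (expo i)" "dP (Inr a) = 0"
  "dQ (Inl i) = 0" "dQ (Inr (Inl j)) = monom 1 (expo j)" "dQ (Inr (Inr k)) = 0"
  "dR (Inl i) = 0" "dR (Inr (Inl j)) = 0" "dR (Inr (Inr k)) = monom 1 (expo (Some k))"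
  by (simp_all add: dP_def dQ_def dR_def)

lemma has_grad_affine:
  assumes "\<And>y. f y = c + (\<Sum>i\<in>UNIV. d $ i * y $ i)"
  shows "has_grad f d x"
proof -
  have "(\<Sum>i\<in>UNIV. d $ i *s axis i 1) = d" by (simp only: vec_eq_sum_axis[symmetric])
  moreover have "has_grad (\<lambda>y. c + (\<Sum>i\<in>UNIV. d $ i * y $ i)) (0 + (\<Sum>i\<in>UNIV. d $ i *s axis i 1)) x"
    by (intro has_grad_add has_grad_const has_grad_sum has_grad_cmult has_grad_nth)
  moreover have "f = (\<lambda>y. c + (\<Sum>i\<in>UNIV. d $ i * y $ i))" using assms by auto
  ultimately show ?thesis by simp
qed

lemma has_pgrad_lax: "has_pgrad laxP dP x" "has_pgrad laxQ dQ x" "has_pgrad laxR dR x"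
  for x :: "('a::real_normed_field, 'g::finite) lax"
proof -
  show "has_pgrad laxP dP x" unfolding has_pgrad_def
    by (rule allI, rule has_grad_affine[where c = "coeff (monom 1 (CARD('g) + 1)) _"])
       (simp add: laxP_def sum_coord coeff_sum mult_if_delta)
  show "has_pgrad laxQ dQ x" unfolding has_pgrad_def
    by (rule allI, rule has_grad_affine[where c = 0])
       (simp add: laxQ_def sum_coord coeff_sum mult_if_delta)
  show "has_pgrad laxR dR x" unfolding has_pgrad_def
    by (rule allI, rule has_grad_affine[where c = "coeff (monom 1 CARD('g)) _"])
       (simp add: laxR_def sum_coord coeff_sum mult_if_delta)
qed

text \<open>For \<open>D\<close> the coordinate derivatives of a polynomial-valued map, this is the
  gradient of the value of that polynomial at \<open>z\<close>.\<close>

definition ev :: "('n \<Rightarrow> 'a::real_normed_field poly) \<Rightarrow> 'a \<Rightarrow> 'a ^ 'n::finite" where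
  "ev D z = (\<chi> i. poly (D i) z)"

lemma ev_nth [simp]: "ev D z $ i = poly (D i) z"
  by (simp add: ev_def)

text \<open>The generating identities with denominators cleared. In this form they hold on the
  diagonal as well and can be fed to \<open>algebra\<close>.\<close>

lemma pb_ev:
  fixes x :: "('a::real_normed_field, 'g::finite) lax"
  shows "pb x (ev dP z) (ev dP w) = 0" "pb x (ev dR z) (ev dR w) = 0"
    and "(z - w) * pb x (ev dP z) (ev dQ w) = 2 * (poly (laxQ x) z - poly (laxQ x) w)"
    and "(z - w) * pb x (ev dP z) (ev dR w) = - 2 * (poly (laxR x) z - poly (laxR x) w)"
    and "pb x (ev dQ z) (ev dQ w) = - 4 * (poly (laxQ x) z - poly (laxQ x) w)"
    and "(z - w) * pb x (ev dQ z) (ev dR w) =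
      4 * (poly (laxP x) z - poly (laxP x) w) - 4 * (z - w) * poly (laxR x) w"
proof -
  have *: "partial_deriv (\<lambda>y. poly (laxP y) z) i x = ev dP z $ i"
    "partial_deriv (\<lambda>y. poly (laxQ y) z) i x = ev dQ z $ i"
    "partial_deriv (\<lambda>y. poly (laxR y) z) i x = ev dR z $ i" for z i
    unfolding partial_deriv_poly_lax
    by (auto simp: dP_def dQ_def dR_def poly_monom split: sum.splits)
  have "bracket (\<lambda>y. poly (laxP y) z) (\<lambda>y. poly (laxP y) w) x = pb x (ev dP z) (ev dP w)"
    "bracket (\<lambda>y. poly (laxR y) z) (\<lambda>y. poly (laxR y) w) x = pb x (ev dR z) (ev dR w)"
    "bracket (\<lambda>y. poly (laxP y) z) (\<lambda>y. poly (laxQ y) w) x = pb x (ev dP z) (ev dQ w)"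
    "bracket (\<lambda>y. poly (laxP y) z) (\<lambda>y. poly (laxR y) w) x = pb x (ev dP z) (ev dR w)"
    "bracket (\<lambda>y. poly (laxQ y) z) (\<lambda>y. poly (laxQ y) w) x = pb x (ev dQ z) (ev dQ w)"
    "bracket (\<lambda>y. poly (laxQ y) z) (\<lambda>y. poly (laxR y) w) x = pb x (ev dQ z) (ev dR w)"
    unfolding bracket_def pb_def * by (rule refl)+
  note eq = this
  show "pb x (ev dP z) (ev dP w) = 0" "pb x (ev dR z) (ev dR w) = 0"
    using bracket_poly(1,2)[where x = x and z = z and w = w] unfolding eq by auto
  show "(z - w) * pb x (ev dP z) (ev dQ w) = 2 * (poly (laxQ x) z - poly (laxQ x) w)"
    using bracket_generating(3)[of z w x] unfolding eq by (cases "z = w") auto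
  show "(z - w) * pb x (ev dP z) (ev dR w) = - 2 * (poly (laxR x) z - poly (laxR x) w)"
    using bracket_generating(4)[of z w x] unfolding eq by (cases "z = w") auto
  show "(z - w) * pb x (ev dQ z) (ev dR w) =
      4 * (poly (laxP x) z - poly (laxP x) w) - 4 * (z - w) * poly (laxR x) w"
    using bracket_generating(6)[of z w x] unfolding eq by (cases "z = w") (auto simp: field_simps)
  show "pb x (ev dQ z) (ev dQ w) = - 4 * (poly (laxQ x) z - poly (laxQ x) w)"
  proof (cases "z = w")
    \<comment> \<open>This identity has no factor \<open>z - w\<close>; on the diagonal it is
      antisymmetry.\<close>
    case True
    then show ?thesis using pb_antisym[of x "ev dQ z" "ev dQ w"] by simp
  next
    case False
    then show ?thesis using bracket_generating(5)[of z w x] unfolding eq by simp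
  qed
qed

text \<open>For fixed \<open>D\<close> the pairing is a polynomial in \<open>z\<close> whose
  coefficients are the entries of \<open>c\<close> belonging to P, Q or R. Hence the evaluation
  covectors outside a finite set span everything.\<close>

lemma covector_eq_0I:
  fixes c :: "'g::finite coord \<Rightarrow> 'a::real_normed_field"
  assumes "finite Z"
    and "\<And>D z. D \<in> {dP, dQ, dR} \<Longrightarrow> z \<notin> Z \<Longrightarrow> (\<Sum>k\<in>UNIV. ev D z $ k * c k) = 0"
  shows "c k = 0"
proof -
  have zero: "(\<Sum>k\<in>UNIV. smult (c k) (D k)) = 0" if "D \<in> {dP, dQ, dR}" for D
    using assms(2)[OF that] by (intro poly_eq_0_cofinite[OF assms(1)]) (simp add: poly_sum mult.commute)
  have "coeff (\<Sum>k\<in>UNIV. smult (c k) (D k)) n = 0" if "D \<in> {dP, dQ, dR}" for D n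
    using zero[OF that] by simp
  then have co: "(\<Sum>k\<in>UNIV. c k * coeff (D k) n) = 0" if "D \<in> {dP, dQ, dR}" for D n
    using that by (simp only: coeff_sum coeff_smult)
  show ?thesis
  proof (cases k)
    case (Inl i)
    then show ?thesis using co[of dP "expo i"] by (simp add: sum_coord inj_expo if_distrib[of "(*) _"] cong: if_cong)
  next
    case (Inr b)
    then show ?thesis
      using co[of dQ "expo (projl b)"] co[of dR "expo (Some (projr b))"]
      by (cases b) (simp_all add: sum_coord inj_expo if_distrib[of "(*) _"] cong: if_cong)
  qed
qed

text \<open>Two applications of \<open>covector_eq_0I\<close>, the first with \<open>w\<close> fixed
  and only the point \<open>z = w\<close> excluded. Generating identities off the diagonal thus
  determine a bivector.\<close>

lemma bivector_eqI:
  fixes X Y :: "'g::finite coord \<Rightarrow> 'g coord \<Rightarrow> 'a::real_normed_field"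
  assumes "\<And>D E z w. D \<in> {dP, dQ, dR} \<Longrightarrow> E \<in> {dP, dQ, dR} \<Longrightarrow> z \<noteq> w \<Longrightarrow>
      (\<Sum>k\<in>UNIV. \<Sum>l\<in>UNIV. X k l * ev D z $ k * ev E w $ l) =
      (\<Sum>k\<in>UNIV. \<Sum>l\<in>UNIV. Y k l * ev D z $ k * ev E w $ l)"
  shows "X k l = Y k l"
proof -
  have "(\<Sum>l\<in>UNIV. ev E w $ l * (X k l - Y k l)) = 0" if "E \<in> {dP, dQ, dR}" for E w k
  proof (rule covector_eq_0I[where Z = "{w}"])
    fix D :: "'g coord \<Rightarrow> 'a poly" and z assume "D \<in> {dP, dQ, dR}" "z \<notin> {w}"
    then show "(\<Sum>k\<in>UNIV. ev D z $ k * (\<Sum>l\<in>UNIV. ev E w $ l * (X k l - Y k l))) = 0"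
      using assms[OF _ that, of D z w]
      by (simp add: sum_distrib_left algebra_simps sum_subtractf)
  qed simp
  then have "X k l - Y k l = 0"
    by (intro covector_eq_0I[where Z = "{}" and c = "\<lambda>l. X k l - Y k l"]) auto
  then show ?thesis by simp
qed

subsection \<open>The map\<close>

abbreviation lead_Q :: "('a::real_normed_field, 'g::finite) lax \<Rightarrow> 'a" where
  "lead_Q x \<equiv> coeff (laxQ x) CARD('g)"

abbreviation sub_Q :: "('a::real_normed_field, 'g::finite) lax \<Rightarrow> 'a" where
  "sub_Q x \<equiv> coeff (laxQ x) (CARD('g) - 1)"

definition shift :: "('a::real_normed_field, 'g::finite) lax \<Rightarrow> 'a" where
  "shift x = - (sub_Q x * inverse (lead_Q x))"

text \<open>Scalars enter as constant polynomials and division as multiplication by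
  \<open>inverse\<close>, so that the product rule of \<open>has_pgrad\<close> applies and
  \<open>algebra\<close> sees ring expressions only.\<close>

definition new_R :: "('a::real_normed_field, 'g::finite) lax \<Rightarrow> 'a poly" where
  "new_R x = [:inverse (lead_Q x):] * laxQ x"

definition new_P :: "('a::real_normed_field, 'g::finite) lax \<Rightarrow> 'a poly" where
  "new_P x = [:2:] * ([:shift x:] + [:0, 1:]) * new_R x - laxP x"

definition new_Q :: "('a::real_normed_field, 'g::finite) lax \<Rightarrow> 'a poly" where
  "new_Q x = [:lead_Q x:] * laxR x - [:2:] * ([:shift x:] + [:0, 1:]) * (new_P x - laxP x)"

lemma lead_Q_d0: "lead_Q x = - 4 * lax_d0 x"
  by (simp add: lax_d0_def)

lemma shift_eq_v0: "shift x = lax_v0 x"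
  by (simp add: shift_def lax_v0_def lax_d0_def field_simps)

text \<open>The defining relations are triangular: the third determines the new R, the second then
  the new P, the first finally the new Q. Each is solved by dividing by a nonzero scalar.\<close>

lemma lax_step_iff_new:
  assumes "lax_d0 x \<noteq> 0"
  shows "lax_step x y \<longleftrightarrow> laxP y = new_P x \<and> laxQ y = new_Q x \<and> laxR y = new_R x"
proof -
  let ?d = "lax_d0 x" and ?u = "[:lax_v0 x, 1:]"
  have u: "[:shift x:] + [:0, 1:] = ?u" by (simp add: shift_eq_v0)
  have c: "smult s p = q \<longleftrightarrow> p = smult (inverse s) q" if "s \<noteq> 0" for s and p q :: "'a poly"
    using that by auto
  have R: "smult (- 4 * ?d) (laxR y) = laxQ x \<longleftrightarrow> laxR y = new_R x"
    using assms by (subst c) (simp_all add: new_R_def lead_Q_d0)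
  have P: "smult (2 * ?d) (laxP y + laxP x) = - (?u * laxQ x) \<longleftrightarrow> laxP y = new_P x"
  proof -
    have "[:2 * ?d:] * [:2:] * [:inverse (lead_Q x):] = - 1"
      using assms by (simp add: lead_Q_d0 one_pCons)
    then have "[:2 * ?d:] * (new_P x + laxP x) = - (?u * laxQ x)"
      unfolding new_P_def u new_R_def by algebra
    then have "smult (2 * ?d) (laxP y + laxP x) = - (?u * laxQ x) \<longleftrightarrow>
        smult (2 * ?d) (laxP y + laxP x) = smult (2 * ?d) (new_P x + laxP x)" by simp
    also have "\<dots> \<longleftrightarrow> laxP y = new_P x"
      using assms by (subst c) (simp_all del: smult_add_right)
    finally show ?thesis .
  qed
  have Q: "?u * (p - laxP x) = - smult (2 * ?d) (laxR x) - smult (1/2) (laxQ y) \<longleftrightarrow>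
      laxQ y = [:lead_Q x:] * laxR x - [:2:] * ?u * (p - laxP x)" for p
  proof -
    have "?u * (p - laxP x) = - smult (2 * ?d) (laxR x) - smult (1/2) (laxQ y) \<longleftrightarrow>
       smult (1/2) (laxQ y) = - smult (2 * ?d) (laxR x) - ?u * (p - laxP x)"
      by (auto simp: algebra_simps)
    also have "\<dots> \<longleftrightarrow> laxQ y = smult 2 (- smult (2 * ?d) (laxR x) - ?u * (p - laxP x))"
      by (subst c) auto
    also have "smult 2 (- smult (2 * ?d) (laxR x) - ?u * (p - laxP x)) =
        [:lead_Q x:] * laxR x - [:2:] * ?u * (p - laxP x)"
      by (simp add: lead_Q_d0 smult_diff_right smult_add_right algebra_simps)
    finally show ?thesis .
  qed
  show ?thesis
    unfolding lax_step_def R P Q new_Q_def u by metis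
qed

lemma lax_domain_iff: "x \<in> lax_domain \<longleftrightarrow> x $ Inl None = 0 \<and> lead_Q x \<noteq> 0"
  by (auto simp: lax_domain_def level_set_iff lax_d0_def)

text \<open>The value of v is chosen so that (\<zeta> + v) R' has no term in
  \<open>\<zeta>\<^sup>g\<close>. As P has none on the level set, neither has P', which keeps the
  image in the level set.\<close>

lemma new_lax_coeffs:
  fixes x :: "('a::real_normed_field, 'g::finite) lax"
  assumes "x \<in> lax_domain"
  shows "coeff (new_P x) (CARD('g) + 1) = 1" "coeff (new_P x) CARD('g) = 0"
    "n > CARD('g) + 1 \<Longrightarrow> coeff (new_P x) n = 0"
    "n > CARD('g) \<Longrightarrow> coeff (new_Q x) n = 0"
    "coeff (new_R x) CARD('g) = 1" "n > CARD('g) \<Longrightarrow> coeff (new_R x) n = 0"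
proof -
  let ?g = "CARD('g)" and ?a = "lead_Q x" and ?v = "shift x"
  have a: "?a \<noteq> 0" and p: "coeff (laxP x) ?g = 0"
    using assms coeff_laxP(1)[of x None] by (auto simp: lax_domain_iff)
  have g: "?g = Suc (?g - 1)" using zero_less_card_finite[where 'a = 'g] by simp
  have u: "coeff ([:2:] * ([:?v:] + [:0, 1:]) * q) (Suc m) = 2 * (?v * coeff q (Suc m) + coeff q m)"
    for q :: "'a poly" and m
    by (simp add: algebra_simps)
  show R1: "coeff (new_R x) ?g = 1" using a by (simp add: new_R_def)
  show R0: "coeff (new_R x) n = 0" if "n > ?g" for n
    using that by (simp add: new_R_def coeff_laxQ(2))
  have R2: "coeff (new_R x) (?g - 1) = - ?v" by (simp add: new_R_def shift_def mult.commute)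
  have P: "coeff (new_P x) (Suc m) =
      2 * (?v * coeff (new_R x) (Suc m) + coeff (new_R x) m) - coeff (laxP x) (Suc m)" for m
    unfolding new_P_def coeff_diff u ..
  show P1: "coeff (new_P x) (?g + 1) = 1"
    using P[of ?g] R1 R0[of "Suc ?g"] coeff_laxP(2)[of x] by simp
  show P0: "coeff (new_P x) ?g = 0"
    using P[of "?g - 1"] R1 R2 p g by simp
  show P2: "coeff (new_P x) n = 0" if "n > ?g + 1" for n
    using that P[of "n - 1"] R0[of n] R0[of "n - 1"] coeff_laxP(3)[of n x] by (cases n) simp_all
  \<comment> \<open>P' and P share the coefficients of index at least g, so P' - P has degree below
    g and (\<zeta> + v) (P' - P) does not exceed the degree allowed for Q'.\<close>
  have D: "coeff (new_P x - laxP x) n = 0" if "n \<ge> ?g" for n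
    using that P1 P0 P2[of n] p coeff_laxP(2)[of x] coeff_laxP(3)[of n x]
    by (cases "n = ?g"; cases "n = ?g + 1") simp_all
  show "coeff (new_Q x) n = 0" if n: "n > ?g" for n
  proof -
    obtain m where m: "n = Suc m" using n by (cases n) auto
    have "coeff (new_Q x) n = ?a * coeff (laxR x) n
        - 2 * (?v * coeff (new_P x - laxP x) (Suc m) + coeff (new_P x - laxP x) m)"
      unfolding new_Q_def coeff_diff[of "[:?a:] * laxR x"] m u by simp
    then show ?thesis using n D[of n] D[of m] coeff_laxR(3)[of n x] by (simp only: m) auto
  qed
qed

lemma new_lax_realized:
  fixes x :: "('a::real_normed_field, 'g::finite) lax"
  assumes "x \<in> lax_domain"
  shows "\<exists>y :: ('a, 'g) lax. laxP y = new_P x \<and> laxQ y = new_Q x \<and> laxR y = new_R x"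
proof -
  note co = new_lax_coeffs[OF assms]
  have "degree (new_P x) = CARD('g) + 1"
    using co(1,3) by (intro antisym degree_le le_degree) auto
  moreover have "degree (new_Q x) \<le> CARD('g)"
    using co(4) by (intro degree_le) auto
  moreover have "degree (new_R x) = CARD('g)"
    using co(5,6) by (intro antisym degree_le le_degree) auto
  ultimately have "(new_P x, new_Q x, new_R x) \<in>
      range (\<lambda>x :: ('a, 'g) lax. (laxP x, laxQ x, laxR x))"
    unfolding range_lax using co(1,5) by simp
  then show ?thesis by (auto simp: image_iff)
qed

text \<open>Existence comes from the degree and leading coefficient checks, uniqueness from the fact
  that the polynomials determine the coordinates. This justifies the \<open>THE\<close> in
  \<open>lax_map\<close>.\<close>

lemma lax_step_unique_exists:
  fixes x :: "('a::real_normed_field, 'g::finite) lax"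
  assumes "x \<in> lax_domain"
  shows "\<exists>!y. lax_step x y"
proof -
  have d: "lax_d0 x \<noteq> 0" using assms by (simp add: lax_domain_def)
  obtain y :: "('a, 'g) lax" where y: "laxP y = new_P x" "laxQ y = new_Q x" "laxR y = new_R x"
    using new_lax_realized[OF assms] by auto
  show ?thesis
  proof
    show "lax_step x y" using y by (simp add: lax_step_iff_new[OF d])
    show "z = y" if "lax_step x z" for z
      using that y injD[OF inj_lax, of z y] by (simp add: lax_step_iff_new[OF d])
  qed
qed

lemma lax_map_new:
  fixes x :: "('a::real_normed_field, 'g::finite) lax"
  assumes "x \<in> lax_domain"
  shows "laxP (lax_map x) = new_P x" "laxQ (lax_map x) = new_Q x" "laxR (lax_map x) = new_R x"
proof -
  have "lax_d0 x \<noteq> 0" using assms by (simp add: lax_domain_def)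
  then show "laxP (lax_map x) = new_P x" "laxQ (lax_map x) = new_Q x" "laxR (lax_map x) = new_R x"
    using theI'[OF lax_step_unique_exists[OF assms]] by (simp_all add: lax_step_iff_new lax_map_def)
qed

lemma lax_map_level_set: "x \<in> lax_domain \<Longrightarrow> lax_map x \<in> level_set"
  using coeff_laxP(1)[of "lax_map x" None] new_lax_coeffs(2)[of x]
  by (simp add: level_set_iff lax_map_new)

text \<open>Invariance of the determinant under conjugation by M, verified by substitution from the
  single relation \<open>a * inverse a = 1\<close> with a the leading coefficient of Q.\<close>

lemma lax_F_lax_map:
  assumes "x \<in> lax_domain"
  shows "lax_F (lax_map x) = lax_F x"
proof -
  have a: "[:lead_Q x:] * [:inverse (lead_Q x):] = 1" using assms by (simp add: lax_domain_iff one_pCons)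
  have "new_P x ^ 2 + new_Q x * new_R x = laxP x ^ 2 + laxQ x * laxR x"
    using a unfolding new_Q_def new_P_def new_R_def by algebra
  then show ?thesis by (simp add: lax_F_def lax_map_new[OF assms])
qed

text \<open>Three entries of the matrix equation are the three defining relations up to
  rearrangement; the upper right entry is a consequence of the other two rows of relations. The
  scalars become polynomials \<open>d\<close> and \<open>h\<close> so that the comparison takes
  place in one ring.\<close>

lemma lax_step_iff_matrix:
  fixes x :: "('a::real_normed_field, 'g::finite) lax"
  assumes "lax_d0 x \<noteq> 0"
  shows "lax_step x y \<longleftrightarrow> lax_matrix x ** lax_M x = lax_M x ** lax_matrix y"
proof -
  let ?d = "lax_d0 x" and ?u = "[:lax_v0 x, 1:]"
  define u d h where "u = ?u" and "d = [:?d:]" and "h = [:1/2 :: 'a:]"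
  have M: "lax_M x = vector [vector [u, h], vector [- (2 * d), 0]]"
    by (simp add: lax_M_def u_def d_def h_def numeral_poly mult.commute)
  have h: "2 * h = 1" and d: "d * [:inverse ?d:] = 1"
    using assms by (simp_all add: h_def d_def numeral_poly one_pCons)
  obtain P Q R P' Q' R' where [simp]: "laxP x = P" "laxQ x = Q" "laxR x = R"
    "laxP y = P'" "laxQ y = Q'" "laxR y = R'" by blast
  have "lax_matrix x ** lax_M x = lax_M x ** lax_matrix y \<longleftrightarrow>
      P * u - 2 * d * R = u * P' + h * Q' \<and> P * h = u * R' - h * P' \<and>
      Q * u + 2 * d * P = - (2 * d * P') \<and> Q * h = - (2 * d * R')"
    unfolding M lax_matrix_def
    by (simp add: vec_eq_iff forall_2 matrix_matrix_mult_def sum_2 algebra_simps)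
  moreover have "lax_step x y \<longleftrightarrow>
      u * (P' - P) = - (2 * d * R) - h * Q' \<and> 2 * d * (P' + P) = - (u * Q) \<and> - (4 * d * R') = Q"
    unfolding lax_step_def u_def d_def h_def by (simp add: numeral_poly mult.commute)
  moreover have "P * u - 2 * d * R = u * P' + h * Q' \<longleftrightarrow> u * (P' - P) = - (2 * d * R) - h * Q'"
    by (auto simp: algebra_simps)
  moreover have "Q * h = - (2 * d * R') \<longleftrightarrow> - (4 * d * R') = Q"
    using h by algebra
  moreover have "Q * u + 2 * d * P = - (2 * d * P') \<longleftrightarrow> 2 * d * (P' + P) = - (u * Q)"
    by algebra
  \<comment> \<open>Eliminating Q gives 2 d (P' + P) = 4 d u R'. Since \<open>d\<close> is
    invertible, P' + P = 2 u R', and multiplication by \<open>h\<close> gives the claim.\<close>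
  moreover have "P * h = u * R' - h * P'" if "2 * d * (P' + P) = - (u * Q)" "- (4 * d * R') = Q"
    using that h d by algebra
  ultimately show ?thesis by blast
qed

section \<open>Restriction to the level set\<close>

lemma to_level_eq: "x \<in> level_set \<Longrightarrow> to_level x = x"
  by (auto simp: to_level_def vec_eq_iff level_set_iff)

lemma laxQ_to_level [simp]: "laxQ (to_level x) = laxQ x" and laxR_to_level [simp]: "laxR (to_level x) = laxR x"
  by (simp_all add: laxQ_def laxR_def to_level_def)

definition dP_level :: "'g::finite coord \<Rightarrow> 'a::real_normed_field poly" where
  "dP_level i = (if i = Inl None then 0 else dP i)"

lemma laxP_to_level:
  fixes x :: "('a::real_normed_field, 'g::finite) lax"
  shows "laxP (to_level x) = laxP x - [:x $ Inl None:] * monom 1 CARD('g)"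
proof -
  have "laxP x = laxP (to_level x) + monom (x $ Inl None) CARD('g)"
    unfolding laxP_def by (simp add: UNIV_option_conv to_level_def sum.reindex add_ac)
  then show ?thesis by (simp add: smult_monom)
qed

lemma has_pgrad_laxP_to_level: "has_pgrad (\<lambda>y. laxP (to_level y)) dP_level x"
  for x :: "('a::real_normed_field, 'g::finite) lax"
proof -
  have "has_pgrad (\<lambda>y. laxP y - [:y $ Inl None:] * monom 1 CARD('g))
     (\<lambda>i. dP i - ([:x $ Inl None:] * 0 + [:axis (Inl None) 1 $ i:] * monom 1 CARD('g))) x"
    by (intro has_pgrad_diff has_pgrad_lax has_pgrad_mult has_pgrad_const has_pgrad_pCons_const has_grad_nth)
  moreover have "(\<lambda>i. dP i - ([:x $ Inl None:] * 0 + [:axis (Inl None) 1 $ i:] * monom 1 CARD('g))) = (dP_level :: 'g coord \<Rightarrow> 'a poly)"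
    by (rule ext) (simp add: dP_level_def axis_def)
  ultimately show ?thesis by (simp only: laxP_to_level)
qed

text \<open>The brackets of this coordinate are coefficients of Q or R of index above g, hence zero.
  Consequently \<open>pb\<close> does not distinguish \<open>dP\<close> from
  \<open>dP_level\<close>.\<close>

lemma bivec_top:
  fixes x :: "('a::real_normed_field, 'g::finite) lax"
  shows "bivec x (Inl None) j = 0" "bivec x j (Inl None) = 0"
proof -
  have "coeff (laxQ x) (Suc (CARD('g) + n)) = 0" "coeff (laxR x) (Suc (CARD('g) + n)) = 0" for n
    by (simp_all add: coeff_laxQ(2) coeff_laxR(3))
  then show "bivec x (Inl None) j = 0"
    by (cases "(x, Inl None :: 'g coord, j)" rule: bivec.cases) simp_all
  then show "bivec x j (Inl None) = 0" using bivec_antisym[of x j] by simp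
qed

lemma ev_dP_level: "ev dP_level z = ev dP z - z ^ CARD('g) *s axis (Inl (None :: 'g::finite option)) 1"
  by (auto simp: vec_eq_iff dP_level_def axis_def poly_monom)

lemma pb_axis_top: "pb x (axis (Inl None) 1) \<beta> = 0" "pb x \<beta> (axis (Inl None) 1) = 0"
  using pb_antisym[of x _ \<beta>] by (simp_all add: pb_axis_right bivec_top)

lemma pb_dP_level: "pb x (ev dP_level z) \<beta> = pb x (ev dP z) \<beta>" "pb x \<beta> (ev dP_level z) = pb x \<beta> (ev dP z)"
  unfolding ev_dP_level by (simp_all add: pb_linear pb_axis_top)

section \<open>The differential of the map\<close>

definition shift_grad :: "('a::real_normed_field, 'g::finite) lax \<Rightarrow> ('a, 'g) lax" where
  "shift_grad x = - inverse (lead_Q x) *s (\<chi> i. coeff (dQ i) (CARD('g) - 1)) +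
     (sub_Q x * (inverse (lead_Q x))\<^sup>2) *s axis (Inr (Inl None)) 1"

lemma has_grad_lead_Q:
  fixes x :: "('a::real_normed_field, 'g::finite) lax"
  shows "has_grad lead_Q (axis (Inr (Inl None)) 1) x"
proof -
  have "has_grad (\<lambda>y. y $ Inr (Inl None)) (axis (Inr (Inl (None :: 'g option))) 1) x" by (rule has_grad_nth)
  moreover have "(\<lambda>y. y $ Inr (Inl None)) = (lead_Q :: ('a, 'g) lax \<Rightarrow> 'a)"
    by (rule ext) (simp add: coeff_laxQ(1)[of _ "None :: 'g option", simplified])
  ultimately show ?thesis by simp
qed

lemma has_grad_shift:
  fixes x :: "('a::real_normed_field, 'g::finite) lax"
  assumes "lead_Q x \<noteq> 0"
  shows "has_grad shift (shift_grad x) x"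
proof -
  have "has_grad (\<lambda>y. - 1 * (sub_Q y * inverse (lead_Q y)))
     (- 1 *s (sub_Q x *s (- (inverse (lead_Q x))\<^sup>2 *s axis (Inr (Inl None)) 1) +
       inverse (lead_Q x) *s (\<chi> i. coeff (dQ i) (CARD('g) - 1)))) x"
    using has_pgrad_lax(2)[of x] assms
    by (intro has_grad_cmult has_grad_mult has_grad_inverse has_grad_lead_Q) (auto simp: has_pgrad_def)
  moreover have "(\<lambda>y. - 1 * (sub_Q y * inverse (lead_Q y))) = (shift :: ('a, 'g) lax \<Rightarrow> 'a)"
    by (auto simp: shift_def)
  moreover have "- 1 *s (sub_Q x *s (- (inverse (lead_Q x))\<^sup>2 *s axis (Inr (Inl None)) 1) +
       inverse (lead_Q x) *s (\<chi> i. coeff (dQ i) (CARD('g) - 1))) = shift_grad x"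
    by (simp add: vec_eq_iff shift_grad_def algebra_simps)
  ultimately show ?thesis by simp
qed

text \<open>This and the next two definitions are the Leibniz derivatives of \<open>new_R\<close>,
  \<open>new_P\<close> and \<open>new_Q\<close> after composition with \<open>to_level\<close>,
  whence \<open>dP_level\<close> in place of \<open>dP\<close>.\<close>

definition dR_new :: "('a::real_normed_field, 'g::finite) lax \<Rightarrow> 'g coord \<Rightarrow> 'a poly" where
  "dR_new x i = [:inverse (lead_Q x):] * dQ i
     - [:(inverse (lead_Q x))\<^sup>2 * axis (Inr (Inl None)) 1 $ i:] * laxQ x"

definition dP_new :: "('a::real_normed_field, 'g::finite) lax \<Rightarrow> 'g coord \<Rightarrow> 'a poly" where
  "dP_new x i = [:2:] * ([:shift x:] + [:0, 1:]) * dR_new x i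
     + [:2 * shift_grad x $ i:] * new_R x - dP_level i"

definition dQ_new :: "('a::real_normed_field, 'g::finite) lax \<Rightarrow> 'g coord \<Rightarrow> 'a poly" where
  "dQ_new x i = [:lead_Q x:] * dR i + [:axis (Inr (Inl None)) 1 $ i:] * laxR x
     - [:2:] * ([:shift x:] + [:0, 1:]) * (dP_new x i - dP_level i)
     - [:2 * shift_grad x $ i:] * (new_P x - laxP x)"

lemma lead_Q_to_level: "lead_Q (to_level x) = lead_Q x" "shift (to_level x) = shift x" "new_R (to_level x) = new_R x"
  by (simp_all add: shift_def new_R_def)

lemma has_pgrad_new:
  fixes x :: "('a::real_normed_field, 'g::finite) lax"
  assumes "x \<in> lax_domain"
  shows "has_pgrad (\<lambda>y. new_P (to_level y)) (dP_new x) x" "has_pgrad (\<lambda>y. new_Q (to_level y)) (dQ_new x) x"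
    "has_pgrad (\<lambda>y. new_R (to_level y)) (dR_new x) x"
proof -
  have a: "lead_Q x \<noteq> 0" and lev: "to_level x = x"
    using assms by (auto simp: lax_domain_iff level_set_iff[symmetric] to_level_eq)
  let ?A = "axis (Inr (Inl None)) 1 :: ('a, 'g) lax"
  have "has_pgrad (\<lambda>y. [:inverse (lead_Q y):] * laxQ y)
     (\<lambda>i. [:inverse (lead_Q x):] * dQ i + [:(- (inverse (lead_Q x))\<^sup>2 *s ?A) $ i:] * laxQ x) x"
    using a by (intro has_pgrad_mult has_pgrad_pCons_const has_grad_inverse has_grad_lead_Q has_pgrad_lax)
  then show R: "has_pgrad (\<lambda>y. new_R (to_level y)) (dR_new x) x"
    by (simp only: new_R_def[symmetric] lead_Q_to_level)
       (simp add: dR_new_def[abs_def])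
  have U: "has_pgrad (\<lambda>y. [:2:] * ([:shift y:] + [:0, 1:])) (\<lambda>i. [:2 * shift_grad x $ i:]) x"
  proof -
    have "has_pgrad (\<lambda>y. [:2:] * ([:shift y:] + [:0, 1:]))
       (\<lambda>i. [:2:] * ([:shift_grad x $ i:] + 0) + 0 * ([:shift x:] + [:0, 1:])) x"
      using a by (intro has_pgrad_mult has_pgrad_add has_pgrad_const has_pgrad_pCons_const has_grad_shift)
    then show ?thesis by (simp add: mult.commute)
  qed
  have "has_pgrad (\<lambda>y. [:2:] * ([:shift y:] + [:0, 1:]) * new_R (to_level y) - laxP (to_level y))
     (\<lambda>i. [:2:] * ([:shift x:] + [:0, 1:]) * dR_new x i + [:2 * shift_grad x $ i:] * new_R (to_level x) - dP_level i) x"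
    by (intro has_pgrad_diff has_pgrad_mult U R has_pgrad_laxP_to_level)
  then show P: "has_pgrad (\<lambda>y. new_P (to_level y)) (dP_new x) x"
    by (simp only: new_P_def dP_new_def[abs_def] lead_Q_to_level)
  have "has_pgrad (\<lambda>y. [:lead_Q y:] * laxR y - [:2:] * ([:shift y:] + [:0, 1:]) * (new_P (to_level y) - laxP (to_level y)))
     (\<lambda>i. [:lead_Q x:] * dR i + [:?A $ i:] * laxR x -
       ([:2:] * ([:shift x:] + [:0, 1:]) * (dP_new x i - dP_level i)
        + [:2 * shift_grad x $ i:] * (new_P (to_level x) - laxP (to_level x)))) x"
    by (intro has_pgrad_diff has_pgrad_mult U P has_pgrad_laxP_to_level has_pgrad_lax
        has_pgrad_pCons_const has_grad_lead_Q)
  then show "has_pgrad (\<lambda>y. new_Q (to_level y)) (dQ_new x) x"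
    by (simp only: new_Q_def dQ_new_def[abs_def] lead_Q_to_level lev laxR_to_level diff_diff_eq)
qed

text \<open>\<open>lax_domain\<close> lies in a hyperplane and contains no ambient neighbourhood.
  Composition with the projection \<open>to_level\<close> supplies one, because the leading
  coefficient of Q is continuous and unchanged by it.\<close>

lemma eventually_to_level_domain:
  fixes x :: "('a::real_normed_field, 'g::finite) lax"
  assumes "x \<in> lax_domain"
  shows "\<forall>\<^sub>F y in nhds x. to_level y \<in> lax_domain"
proof -
  have "\<forall>\<^sub>F y in nhds x. y $ Inr (Inl None) \<noteq> 0"
  proof (rule eventually_nhds[THEN iffD2], intro exI conjI ballI)
    show "open {y :: ('a, 'g) lax. y $ Inr (Inl None) \<noteq> 0}"
      by (intro open_Collect_neq continuous_intros)
    show "x \<in> {y. y $ Inr (Inl None) \<noteq> 0}"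
      using assms coeff_laxQ(1)[of x None] by (simp add: lax_domain_iff)
  qed simp
  then show ?thesis
  proof eventually_elim
    case (elim y)
    then show ?case
      using coeff_laxQ(1)[of y None] by (simp add: lax_domain_iff) (simp add: to_level_def)
  qed
qed

text \<open>The rows of the Jacobian matrix of \<open>lax_map \<circ> to_level\<close>.\<close>

definition lax_map_grad :: "('a::real_normed_field, 'g::finite) lax \<Rightarrow> 'g coord \<Rightarrow> ('a, 'g) lax" where
  "lax_map_grad x k = (case k of Inl i \<Rightarrow> \<chi> l. coeff (dP_new x l) (expo i)
     | Inr (Inl i) \<Rightarrow> \<chi> l. coeff (dQ_new x l) (expo i)
     | Inr (Inr i) \<Rightarrow> \<chi> l. coeff (dR_new x l) (expo (Some i)))"

lemma has_pgrad_lax_map: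
  fixes x :: "('a::real_normed_field, 'g::finite) lax"
  assumes "x \<in> lax_domain"
  shows "has_pgrad (\<lambda>y. laxP (lax_map (to_level y))) (dP_new x) x"
    "has_pgrad (\<lambda>y. laxQ (lax_map (to_level y))) (dQ_new x) x"
    "has_pgrad (\<lambda>y. laxR (lax_map (to_level y))) (dR_new x) x"
  by (rule has_pgrad_transform_eventually[OF has_pgrad_new(1)[OF assms]]
        has_pgrad_transform_eventually[OF has_pgrad_new(2)[OF assms]]
        has_pgrad_transform_eventually[OF has_pgrad_new(3)[OF assms]],
      rule eventually_mono[OF eventually_to_level_domain[OF assms]], simp add: lax_map_new)+

lemma has_grad_lax_map:
  fixes x :: "('a::real_normed_field, 'g::finite) lax"
  assumes "x \<in> lax_domain"
  shows "has_grad (\<lambda>y. lax_map (to_level y) $ k) (lax_map_grad x k) x"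
proof -
  note pg = has_pgrad_lax_map[OF assms, unfolded has_pgrad_def]
  consider i where "k = Inl i" | i where "k = Inr (Inl i)" | i where "k = Inr (Inr i)"
    by (metis sumE)
  then show ?thesis
  proof cases
    case 1
    then show ?thesis using pg(1)[rule_format, of "expo (projl k)"] by (simp add: coeff_laxP(1) lax_map_grad_def)
  next
    case 2
    then show ?thesis using pg(2)[rule_format, of "expo (projl (projr k))"] by (simp add: coeff_laxQ(1) lax_map_grad_def)
  next
    case 3
    then show ?thesis using pg(3)[rule_format, of "expo (Some (projr (projr k)))"] by (simp add: coeff_laxR(1) lax_map_grad_def)
  qed
qed

lemma poly_eq_sum_atMost:
  fixes z :: "'a::comm_semiring_1"
  assumes "\<And>n. n > N \<Longrightarrow> coeff p n = 0"
  shows "poly p z = (\<Sum>n\<le>N. coeff p n * z ^ n)"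
proof -
  have "degree p \<le> N" using assms by (intro degree_le) auto
  then have "(\<Sum>n\<le>N. coeff p n * z ^ n) = (\<Sum>n\<le>degree p. coeff p n * z ^ n)"
    by (intro sum.mono_neutral_right) (auto simp: coeff_eq_0)
  then show ?thesis by (simp add: poly_altdef)
qed

text \<open>Pullback of the evaluation covectors by the map. The left sides run over the free
  coefficients only; nothing is lost, because the fixed coefficients of the image are constant and
  have zero gradient.\<close>

lemma ev_new:
  fixes x :: "('a::real_normed_field, 'g::finite) lax"
  assumes "x \<in> lax_domain"
  shows "(\<Sum>k\<in>UNIV. ev dP z $ k *s lax_map_grad x k) = ev (dP_new x) z"
    "(\<Sum>k\<in>UNIV. ev dQ z $ k *s lax_map_grad x k) = ev (dQ_new x) z"
    "(\<Sum>k\<in>UNIV. ev dR z $ k *s lax_map_grad x k) = ev (dR_new x) z"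
proof -
  note pg = has_pgrad_lax_map[OF assms, unfolded has_pgrad_def, rule_format]
  \<comment> \<open>A coefficient that is constant along the map has zero gradient, by uniqueness of
    gradients.\<close>
  have const: "coeff (D i) n = 0"
    if "has_grad (\<lambda>y. coeff (p y) n) (\<chi> i. coeff (D i) n) x" "\<And>y. coeff (p y) n = c" for p D n c i
  proof -
    have "(\<lambda>y. coeff (p y) n) = (\<lambda>_. c)" using that(2) by auto
    then have "(\<chi> i. coeff (D i) n) = 0" using has_grad_unique[OF that(1)] has_grad_const[of c x] by simp
    then show ?thesis by (metis vec_lambda_beta zero_index)
  qed
  have hi: "coeff (dP_new x i) n = 0" "coeff (dQ_new x i) n = 0" if "n > CARD('g)" for n i
  proof -
    show "coeff (dQ_new x i) n = 0"
      by (rule const[OF pg(2)]) (rule coeff_laxQ(2)[OF that])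
    show "coeff (dP_new x i) n = 0"
      \<comment> \<open>The constant is 1 at the leading index g + 1 and 0 beyond it.\<close>
      using that coeff_laxP(2)[where 'g = 'g and 'a = 'a] coeff_laxP(3)[where 'g = 'g and 'a = 'a and n = n]
      by (intro const[where c = "if n = CARD('g) + 1 then 1 else 0", OF pg(1)]) auto
  qed
  have hiR: "coeff (dR_new x i) n = 0" if "n \<ge> CARD('g)" for n i
    using that coeff_laxR(2)[where 'g = 'g and 'a = 'a] coeff_laxR(3)[where 'g = 'g and 'a = 'a and n = n]
    by (intro const[where c = "if n = CARD('g) then 1 else 0", OF pg(3)]) auto
  show "(\<Sum>k\<in>UNIV. ev dP z $ k *s lax_map_grad x k) = ev (dP_new x) z"
    "(\<Sum>k\<in>UNIV. ev dQ z $ k *s lax_map_grad x k) = ev (dQ_new x) z"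
    "(\<Sum>k\<in>UNIV. ev dR z $ k *s lax_map_grad x k) = ev (dR_new x) z"
    unfolding vec_eq_iff
  proof (safe, goal_cases)
    case (1 i)
    have "poly (dP_new x i) z = (\<Sum>n\<le>CARD('g). coeff (dP_new x i) n * z ^ n)"
      by (rule poly_eq_sum_atMost[OF hi(1)])
    then show ?case
      unfolding sum_expo[symmetric]
      by (simp add: sum_coord lax_map_grad_def poly_monom mult.commute)
  next
    case (2 i)
    have "poly (dQ_new x i) z = (\<Sum>n\<le>CARD('g). coeff (dQ_new x i) n * z ^ n)"
      by (rule poly_eq_sum_atMost[OF hi(2)])
    then show ?case
      unfolding sum_expo[symmetric]
      by (simp add: sum_coord lax_map_grad_def poly_monom mult.commute)
  next
    case (3 i)
    have "poly (dR_new x i) z = (\<Sum>n<CARD('g). coeff (dR_new x i) n * z ^ n)"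
      using poly_eq_sum_atMost[where N = "CARD('g)" and p = "dR_new x i" and z = z] hiR[of _ i]
      by (simp add: lessThan_Suc_atMost[symmetric])
    then show ?case
      unfolding sum_expo_Some[symmetric]
      by (simp add: sum_coord lax_map_grad_def poly_monom mult.commute)
  qed
qed

subsection \<open>The Poisson property\<close>

lemma pb_axis_left: "pb x (axis k 1) \<beta> = (\<Sum>j\<in>UNIV. bivec x k j * \<beta> $ j)"
proof -
  have "bivec x k j = - bivec x j k" for j by (rule bivec_antisym)
  then have "(\<Sum>j\<in>UNIV. bivec x k j * \<beta> $ j) = (\<Sum>j\<in>UNIV. - (bivec x j k * \<beta> $ j))"
    by (intro sum.cong refl) (metis mult_minus_left)
  then show ?thesis
    using pb_antisym[of x "axis k 1" \<beta>] by (simp add: pb_axis_right sum_negf)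
qed

lemma sum_eq_first:
  fixes f :: "nat \<Rightarrow> 'a::comm_monoid_add"
  assumes "finite S" "0 \<in> S" "\<And>n. n > 0 \<Longrightarrow> f n = 0"
  shows "sum f S = f 0"
  using assms by (subst sum.mono_neutral_right[of S "{0}"]) auto

text \<open>
  For \<open>g = 1\<close> the coefficient \<open>b\<close> is the constant term of \<open>Q\<close>, which enters the bracket differently from the
  higher ones. The additional terms cancel in all brackets of the new matrix.
\<close>

definition genus_one_defect :: "'g::finite itself \<Rightarrow> 'a::real_normed_field" where
  "genus_one_defect _ = (if CARD('g) = 1 then 4 else 0)"

lemma obtain_sub_index:
  obtains m :: "'g::finite option" where "expo m = CARD('g) - 1"
proof -
  have "CARD('g) - 1 \<in> range (expo :: 'g option \<Rightarrow> nat)"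
    using bij_betw_expo[where 'g = 'g] by (simp add: bij_betw_def)
  then show ?thesis using that by (auto simp: image_iff)
qed

text \<open>\<open>A\<close> is the gradient of the leading coefficient a of Q. Pairing it with
  w-expansions leaves only the constant term: every higher term carries a coefficient beyond the
  degree of P, Q or R, or a Kronecker delta at exponent 0.\<close>

lemma pb_lead_Q:
  fixes x :: "('a::real_normed_field, 'g::finite) lax"
  defines "A \<equiv> axis (Inr (Inl None)) 1 :: ('a, 'g) lax"
  shows "pb x A (ev dP w) = 0" "pb x A (ev dQ w) = - 4 * lead_Q x" "pb x A (ev dR w) = 4"
proof -
  let ?g = "CARD('g)"
  have g: "?g > 0" by simp
  show "pb x A (ev dP w) = 0"
    by (simp add: A_def pb_axis_left sum_coord coeff_laxQ(2))
  have "pb x A (ev dQ w) = (\<Sum>j\<in>UNIV. - 4 * (if expo (j :: 'g option) = 0 then lead_Q x else 0) * w ^ expo j)"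
    by (simp add: A_def pb_axis_left sum_coord poly_monom cong: if_cong)
  also have "\<dots> = (\<Sum>n\<le>?g. - 4 * (if n = 0 then lead_Q x else 0) * w ^ n)"
    by (rule sum_expo)
  also have "\<dots> = - 4 * lead_Q x" by (subst sum_eq_first) auto
  finally show "pb x A (ev dQ w) = - 4 * lead_Q x" .
  have "pb x A (ev dR w) = (\<Sum>k\<in>UNIV. 4 * coeff (laxP x) (?g + expo (Some (k :: 'g)) + 1) * w ^ expo (Some k))"
    by (simp add: A_def pb_axis_left sum_coord poly_monom)
  also have "\<dots> = (\<Sum>n<?g. 4 * coeff (laxP x) (?g + n + 1) * w ^ n)"
    by (rule sum_expo_Some)
  also have "\<dots> = 4"
    using coeff_laxP(2)[of x] coeff_laxP(3)[where x = x] g by (subst sum_eq_first) auto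
  finally show "pb x A (ev dR w) = 4" .
qed

text \<open>\<open>B\<close> is the gradient of the second coefficient b of Q. Its index is one
  lower, so a linear term in w can survive against R. The constant term there vanishes because the
  level set kills the coefficient of \<open>\<zeta>\<^sup>g\<close> in P.\<close>

lemma pb_sub_Q:
  fixes x :: "('a::real_normed_field, 'g::finite) lax"
  assumes "x \<in> level_set"
  defines "A \<equiv> axis (Inr (Inl None)) 1 :: ('a, 'g) lax" and "B \<equiv> (\<chi> i. coeff (dQ i) (CARD('g) - 1)) :: ('a, 'g) lax"
    and "e \<equiv> genus_one_defect TYPE('g)"
  shows "pb x B (ev dP w) = - 2 * lead_Q x" "pb x B (ev dQ w) = - 4 * sub_Q x + e * poly (laxQ x) w"
    "pb x B (ev dR w) = 4 * w - e * poly (laxR x) w" "pb x A B = - e * lead_Q x"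
proof -
  let ?g = "CARD('g)"
  have g: "?g > 0" by simp
  then have g1: "?g \<le> Suc 0 \<longleftrightarrow> ?g = Suc 0" by linarith
  obtain m :: "'g option" where m: "expo m = ?g - 1" by (rule obtain_sub_index)
  have B: "B = axis (Inr (Inl m)) 1"
  proof -
    have "coeff (dQ i) (?g - 1) = (axis (Inr (Inl m)) 1 :: ('a, 'g) lax) $ i" for i
      unfolding m[symmetric] by (cases "i"; cases "projr i") (auto simp: axis_def inj_expo)
    then show ?thesis by (simp add: B_def vec_eq_iff)
  qed
  have "pb x B (ev dP w) = (\<Sum>j\<in>UNIV. - 2 * coeff (laxQ x) (?g + expo (j :: 'g option)) * w ^ expo j)"
    using g by (simp add: B pb_axis_left sum_coord poly_monom m)
  also have "\<dots> = (\<Sum>n\<le>?g. - 2 * coeff (laxQ x) (?g + n) * w ^ n)"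
    by (rule sum_expo)
  also have "\<dots> = - 2 * lead_Q x"
    by (subst sum_eq_first) (auto simp: coeff_laxQ(2))
  finally show "pb x B (ev dP w) = - 2 * lead_Q x" .
  have "pb x B (ev dQ w) = (\<Sum>j\<in>UNIV. - 4 * (if expo (j :: 'g option) = 0 then sub_Q x else 0) * w ^ expo j)
      + (\<Sum>j\<in>UNIV. e * (coeff (laxQ x) (expo (j :: 'g option)) * w ^ expo j))"
    unfolding sum.distrib[symmetric] using g
    by (auto simp: B pb_axis_left sum_coord poly_monom m e_def genus_one_defect_def g1 algebra_simps
        intro!: sum.cong)
  also have "\<dots> = (\<Sum>n\<le>?g. - 4 * (if n = 0 then sub_Q x else 0) * w ^ n) + e * poly (laxQ x) w"
    unfolding sum_distrib_left[symmetric] poly_laxQ_expo[symmetric] by (subst sum_expo) (rule refl)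
  also have "\<dots> = - 4 * sub_Q x + e * poly (laxQ x) w" by (subst sum_eq_first) auto
  finally show "pb x B (ev dQ w) = - 4 * sub_Q x + e * poly (laxQ x) w" .
  have "pb x B (ev dR w) = (\<Sum>k\<in>UNIV. (4 * coeff (laxP x) (?g + expo (Some (k :: 'g)))
      - e * coeff (laxR x) (expo (Some k))) * w ^ expo (Some k))"
    using g by (auto simp: B pb_axis_left sum_coord poly_monom m e_def genus_one_defect_def g1 intro!: sum.cong)
  also have "\<dots> = (\<Sum>n<?g. (4 * coeff (laxP x) (?g + n) - e * coeff (laxR x) n) * w ^ n)"
    by (rule sum_expo_Some)
  also have "\<dots> = 4 * w - e * poly (laxR x) w"
  \<comment> \<open>For g = 1 the sum has no linear term; 4 w is then cancelled by the leading term
    of e R. For g > 1 the defect is zero and only n = 1 contributes.\<close>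
  proof (cases "?g = 1")
    case True
    have "poly (laxR x) w = coeff (laxR x) 0 + w"
      using poly_eq_sum_atMost[where N = ?g and p = "laxR x" and z = w] coeff_laxR(2,3)[where x = x] True by simp
    moreover have "coeff (laxP x) ?g = 0"
      using assms(1) coeff_laxP(1)[of x None] by (simp add: level_set_iff)
    ultimately show ?thesis using True by (simp add: e_def genus_one_defect_def algebra_simps)
  next
    case False
    have "(\<Sum>n<?g. 4 * coeff (laxP x) (?g + n) * w ^ n) = (\<Sum>n\<in>{1}. 4 * coeff (laxP x) (?g + n) * w ^ n)"
    proof (rule sum.mono_neutral_right)
      show "\<forall>n\<in>{..<?g} - {1}. 4 * coeff (laxP x) (?g + n) * w ^ n = 0"
      proof
        fix n assume "n \<in> {..<?g} - {1}"
        then consider "n = 0" | "n > 1" by fastforce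
        then show "4 * coeff (laxP x) (?g + n) * w ^ n = 0"
          using assms(1) coeff_laxP(1)[of x None] by cases (auto simp: level_set_iff coeff_laxP(3))
      qed
    qed (use False g in \<open>auto simp del: zero_less_card_finite\<close>)
    then show ?thesis using False coeff_laxP(2)[of x] by (simp add: e_def genus_one_defect_def)
  qed
  finally show "pb x B (ev dR w) = 4 * w - e * poly (laxR x) w" .
  show "pb x A B = - e * lead_Q x"
    using g by (auto simp: A_def B pb_axis_axis m e_def genus_one_defect_def g1)
qed

text \<open>The quotient rule turns the brackets of a and b into those of v = - b / a. Up to the
  genus one defect, v commutes with a and Q, and its bracket with P(w) is the constant 2.\<close>

lemma pb_shift:
  fixes x :: "('a::real_normed_field, 'g::finite) lax"
  assumes "x \<in> lax_domain"
  defines "A \<equiv> axis (Inr (Inl None)) 1 :: ('a, 'g) lax" and "V \<equiv> shift_grad x"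
    and "e \<equiv> genus_one_defect TYPE('g)"
  shows "pb x V (ev dP w) = 2" "pb x V (ev dQ w) = - (e * poly (laxQ x) w) / lead_Q x"
    "pb x V (ev dR w) = (e * poly (laxR x) w - 4 * (w + shift x)) / lead_Q x"
    "pb x A V = e"
proof -
  have x: "x \<in> level_set" and a: "lead_Q x \<noteq> 0"
    using assms(1) by (auto simp: lax_domain_iff level_set_iff)
  have AA: "pb x A A = 0" using pb_antisym[of x A A] by simp
  note pbs = pb_sub_Q[OF x] pb_lead_Q
  show "pb x V (ev dP w) = 2" "pb x V (ev dQ w) = - (e * poly (laxQ x) w) / lead_Q x"
    "pb x V (ev dR w) = (e * poly (laxR x) w - 4 * (w + shift x)) / lead_Q x"
    "pb x A V = e"
    using a AA unfolding V_def shift_grad_def A_def e_def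
    by (simp_all add: pb_linear pbs shift_def field_simps power2_eq_square del: One_nat_def)
qed

section \<open>Brackets of the new generating functions\<close>

lemma ev_dR_new: "ev (dR_new x) z = inverse (lead_Q x) *s ev dQ z
    - ((inverse (lead_Q x))\<^sup>2 * poly (laxQ x) z) *s axis (Inr (Inl None)) 1"
  by (simp add: vec_eq_iff dR_new_def)

lemma ev_dP_new: "ev (dP_new x) z = (2 * (z + shift x)) *s ev (dR_new x) z
    + (2 * poly (new_R x) z) *s shift_grad x - ev dP_level z"
  by (simp add: vec_eq_iff dP_new_def algebra_simps)

lemma ev_dQ_new: "ev (dQ_new x) z = lead_Q x *s ev dR z + poly (laxR x) z *s axis (Inr (Inl None)) 1
    - (4 * (z + shift x)\<^sup>2) *s ev (dR_new x) z + (4 * (z + shift x)) *s ev dP_level z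
    + (4 * poly (laxP x) z - 8 * (z + shift x) * poly (new_R x) z) *s shift_grad x"
  by (simp add: vec_eq_iff dQ_new_def dP_new_def new_P_def algebra_simps power2_eq_square)

text \<open>The new covectors are combinations of five kinds: those of P, R and R', and the
  gradients \<open>A\<close> of a and \<open>V\<close> of v. It suffices to tabulate the brackets
  among these and expand bilinearly; what remains are polynomial identities after multiplication by
  \<open>z - w\<close>.\<close>

lemma pb_new:
  fixes x :: "('a::real_normed_field, 'g::finite) lax"
  assumes x: "x \<in> lax_domain" and zw: "z \<noteq> w"
  shows "pb x (ev (dP_new x) z) (ev (dP_new x) w) = 0"
    and "pb x (ev (dR_new x) z) (ev (dR_new x) w) = 0"
    and "(z - w) * pb x (ev (dP_new x) z) (ev (dQ_new x) w) = 2 * (poly (new_Q x) z - poly (new_Q x) w)"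
    and "(z - w) * pb x (ev (dP_new x) z) (ev (dR_new x) w) = - 2 * (poly (new_R x) z - poly (new_R x) w)"
    and "pb x (ev (dQ_new x) z) (ev (dQ_new x) w) = - 4 * (poly (new_Q x) z - poly (new_Q x) w)"
    and "(z - w) * pb x (ev (dQ_new x) z) (ev (dR_new x) w) =
      4 * (poly (new_P x) z - poly (new_P x) w) - 4 * (z - w) * poly (new_R x) w"
proof -
  define a v e where "a = lead_Q x" and "v = shift x" and "e = (genus_one_defect TYPE('g) :: 'a)"
  have a: "a \<noteq> 0" and d: "z - w \<noteq> 0" "w - z \<noteq> 0"
    using x zw by (auto simp: lax_domain_iff a_def)
  define p r R where "p = poly (laxP x)" and "r = poly (new_R x)" and "R = poly (laxR x)"
  \<comment> \<open>Q is eliminated in favour of the monic R' = Q / a.\<close>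
  have Q: "poly (laxQ x) t = a * r t" for t using a by (simp add: r_def new_R_def a_def)
  define A V where "A = (axis (Inr (Inl None)) 1 :: ('a, 'g) lax)" and "V = shift_grad x"
  define eP eR eT where "eP = (ev dP_level :: 'a \<Rightarrow> ('a, 'g) lax)"
    and "eR = (ev dR :: 'a \<Rightarrow> ('a, 'g) lax)" and "eT = ev (dR_new x)"
  have T: "eT t = (1 / a) *s ev dQ t - (r t / a) *s A" for t
    unfolding eT_def ev_dR_new A_def a_def[symmetric] Q using a by (simp add: field_simps power2_eq_square)
  have P': "ev (dP_new x) t = (2 * (t + v)) *s eT t + (2 * r t) *s V - eP t" for t
    by (simp add: ev_dP_new eT_def V_def eP_def v_def r_def)
  have Q': "ev (dQ_new x) t = a *s eR t + R t *s A - (4 * (t + v)\<^sup>2) *s eT t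
     + (4 * (t + v)) *s eP t + (4 * p t - 8 * (t + v) * r t) *s V" for t
    by (simp add: ev_dQ_new eT_def V_def eP_def v_def r_def eR_def a_def A_def R_def p_def)
  have nP: "poly (new_P x) t = 2 * (t + v) * r t - p t" for t
    by (simp add: new_P_def r_def p_def v_def algebra_simps)
  have nQ: "poly (new_Q x) t = a * R t - 2 * (t + v) * (poly (new_P x) t - p t)" for t
    by (simp add: new_Q_def R_def p_def v_def a_def algebra_simps)
  note shift = pb_shift[OF x, folded A_def V_def a_def v_def e_def, unfolded Q, folded R_def eR_def]
  have AA: "pb x A A = 0" and VV: "pb x V V = 0" using pb_antisym[of x A A] pb_antisym[of x V V] by auto
  have A_P: "pb x A (eP t) = 0" and A_R: "pb x A (eR t) = 4" and A_V: "pb x A V = e"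
    and A_T: "pb x A (eT t) = - 4" for t
    using a by (auto simp: T pb_linear AA pb_lead_Q[of x, folded A_def a_def eR_def] eP_def pb_dP_level shift)
  have V_P: "pb x V (eP t) = 2" and V_R: "pb x V (eR t) = (e * R t - 4 * (t + v)) / a"
    and V_A: "pb x V A = - e" for t
    using A_V pb_antisym[of x V A] by (simp_all add: eP_def pb_dP_level shift)
  \<comment> \<open>Here the genus one terms from {v, Q} and from {v, a} cancel, so v commutes with
    R'.\<close>
  have V_T: "pb x V (eT t) = 0" for t
    using a by (simp add: T pb_linear shift V_A)
  have P_P: "pb x (eP s) (eP t) = 0" and R_R: "pb x (eR s) (eR t) = 0" for s t
    by (simp_all add: eP_def eR_def pb_dP_level pb_ev)
  have P_R: "pb x (eP s) (eR t) = - 2 * (R s - R t) / (s - t)" if "s \<noteq> t" for s t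
    using pb_ev(4)[where x = x and z = s and w = t, folded eR_def R_def] that
    by (simp add: eP_def pb_dP_level field_simps)
  have P_Q: "pb x (eP s) (ev dQ t) = 2 * a * (r s - r t) / (s - t)" if "s \<noteq> t" for s t
    using pb_ev(3)[where x = x and z = s and w = t, unfolded Q] that
    by (simp add: eP_def pb_dP_level field_simps)
  have Q_R: "pb x (ev dQ s) (eR t) = 4 * (p s - p t) / (s - t) - 4 * R t" if "s \<noteq> t" for s t
    using pb_ev(6)[where x = x and z = s and w = t, folded eR_def R_def p_def] that
    by (simp add: field_simps)
  have P_T: "pb x (eP s) (eT t) = 2 * (r s - r t) / (s - t)" if "s \<noteq> t" for s t
    using that a pb_antisym[of x "eP s" A] by (simp add: T pb_linear P_Q A_P)
  \<comment> \<open>Dividing Q by its leading coefficient makes its values commute: the terms with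
    \<open>A\<close> compensate {Q, Q}.\<close>
  have T_T: "pb x (eT s) (eT t) = 0" for s t
    using a pb_ev(5)[where x = x and z = s and w = t, unfolded Q] pb_antisym[of x "ev dQ s" A]
    by (simp add: T pb_linear AA pb_lead_Q[of x, folded A_def a_def] field_simps)
  have T_R: "pb x (eT s) (eR t) = (4 * (p s - p t) / (s - t) - 4 * R t - 4 * r s) / a" if "s \<noteq> t" for s t
    using that a by (simp add: T pb_linear Q_R A_R field_simps)
  have R_A: "pb x (eR t) A = - 4" and T_A: "pb x (eT t) A = 4" and P_A: "pb x (eP t) A = 0"
    and P_V: "pb x (eP t) V = - 2" and T_V: "pb x (eT t) V = 0"
    and R_V: "pb x (eR t) V = - ((e * R t - 4 * (t + v)) / a)" for t
    using A_R[of t] A_T[of t] A_P[of t] V_P[of t] V_T[of t] V_R[of t]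
      pb_antisym[of x "eR t" A] pb_antisym[of x "eT t" A] pb_antisym[of x "eP t" A]
      pb_antisym[of x "eR t" V] pb_antisym[of x "eT t" V] pb_antisym[of x "eP t" V] by simp_all
  have R_P: "pb x (eR s) (eP t) = 2 * (R t - R s) / (t - s)" and
    T_P: "pb x (eT s) (eP t) = - 2 * (r t - r s) / (t - s)" and
    R_T: "pb x (eR s) (eT t) = - ((4 * (p t - p s) / (t - s) - 4 * R s - 4 * r t) / a)"
    if "s \<noteq> t" for s t
    using P_R[of t s] P_T[of t s] T_R[of t s] that
      pb_antisym[of x "eR s" "eP t"] pb_antisym[of x "eT s" "eP t"] pb_antisym[of x "eR s" "eT t"]
    by (simp_all add: minus_divide_left)
  note basic = AA VV A_P A_R A_V A_T V_P V_R V_A V_T P_P R_R P_R[OF zw] P_T[OF zw] T_T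
    T_R[OF zw] R_A T_A P_A P_V T_V R_V R_P[OF zw] T_P[OF zw] R_T[OF zw]
  note basic0 = AA VV A_P A_R A_V A_T V_P V_A V_T P_P R_R T_T R_A T_A P_A P_V T_V
  \<comment> \<open>The entries with denominators are restated as polynomial relations, the form in
    which \<open>algebra\<close> can use them.\<close>
  have PR: "(z - w) * pb x (eP z) (eR w) = - 2 * (R z - R w)"
    and PT: "(z - w) * pb x (eP z) (eT w) = 2 * (r z - r w)"
    and RP: "(z - w) * pb x (eR z) (eP w) = 2 * (R z - R w)"
    and TP: "(z - w) * pb x (eT z) (eP w) = - 2 * (r z - r w)"
    and TR: "(z - w) * (a * pb x (eT z) (eR w)) = 4 * (p z - p w) - (z - w) * (4 * R w + 4 * r z)"
    and RT: "(z - w) * (a * pb x (eR z) (eT w)) = - (4 * (p z - p w)) + (z - w) * (4 * R z + 4 * r w)"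
    and RV: "a * pb x (eR z) V = 4 * (z + v) - e * R z"
    using d a unfolding P_R[OF zw] P_T[OF zw] R_P[OF zw] T_P[OF zw] T_R[OF zw] R_T[OF zw] R_V
    by (simp_all add: field_simps)
  have V_Q': "pb x V (ev (dQ_new x) w) = 4 * (w + v)"
    unfolding Q' using a by (simp add: pb_linear basic field_simps)
  have A_Q': "pb x A (ev (dQ_new x) w) = 4 * a + 16 * (w + v)\<^sup>2 + e * (4 * p w - 8 * (w + v) * r w)"
    unfolding Q' by (simp add: pb_linear basic algebra_simps)
  have P_Q': "(z - w) * pb x (eP z) (ev (dQ_new x) w) = - 2 * a * (R z - R w)
      - 8 * (w + v)\<^sup>2 * (r z - r w) - (z - w) * (8 * p w - 16 * (w + v) * r w)"
    unfolding Q' pb_linear basic0 using PR PT by algebra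
  have T_Q': "(z - w) * pb x (eT z) (ev (dQ_new x) w) = 4 * (p z - p w) - (z - w) * (4 * r z)
      - 8 * (w + v) * (r z - r w)"
    unfolding Q' pb_linear basic0 using TR TP by algebra
  have R_Q': "(z - w) * a * pb x (eR z) (ev (dQ_new x) w) = - 4 * (z - w) * a * R w
      - 4 * (w + v)\<^sup>2 * (- 4 * (p z - p w) + 4 * (z - w) * (R z + r w))
      + 8 * a * (w + v) * (R z - R w)
      - (z - w) * (4 * p w - 8 * (w + v) * r w) * (e * R z - 4 * (z + v))"
    unfolding Q' pb_linear basic0 using RT RP RV by algebra
  show "pb x (ev (dR_new x) z) (ev (dR_new x) w) = 0" using T_T by (simp add: eT_def)
  show "pb x (ev (dP_new x) z) (ev (dP_new x) w) = 0"
  proof -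
    have "(z - w) * pb x (ev (dP_new x) z) (ev (dP_new x) w) = 0"
      unfolding P' pb_linear basic0 using PT TP by algebra
    then show ?thesis using d by simp
  qed
  show "(z - w) * pb x (ev (dP_new x) z) (ev (dR_new x) w) = - 2 * (poly (new_R x) z - poly (new_R x) w)"
    unfolding P' eT_def[symmetric] r_def[symmetric] pb_linear basic0 using PT by algebra
  show "(z - w) * pb x (ev (dP_new x) z) (ev (dQ_new x) w) = 2 * (poly (new_Q x) z - poly (new_Q x) w)"
    unfolding P' nQ nP pb_linear using V_Q' P_Q' T_Q' by algebra
  show "pb x (ev (dQ_new x) z) (ev (dQ_new x) w) = - 4 * (poly (new_Q x) z - poly (new_Q x) w)"
  proof -
    \<comment> \<open>Only the left argument is expanded, since the brackets of all its constituents
      with Q'(w) have just been found.\<close>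
    have "(z - w) * pb x (ev (dQ_new x) z) (ev (dQ_new x) w) =
        (z - w) * a * pb x (eR z) (ev (dQ_new x) w) + (z - w) * R z * pb x A (ev (dQ_new x) w)
        - 4 * (z + v)\<^sup>2 * ((z - w) * pb x (eT z) (ev (dQ_new x) w))
        + 4 * (z + v) * ((z - w) * pb x (eP z) (ev (dQ_new x) w))
        + (z - w) * (4 * p z - 8 * (z + v) * r z) * pb x V (ev (dQ_new x) w)"
      unfolding Q'[of z] pb_left_linear by (simp add: algebra_simps)
    also have "\<dots> = (z - w) * (- 4 * (poly (new_Q x) z - poly (new_Q x) w))"
      unfolding V_Q' P_Q' T_Q' R_Q' A_Q' nQ nP by algebra
    finally show ?thesis using d by simp
  qed
  show "(z - w) * pb x (ev (dQ_new x) z) (ev (dR_new x) w) =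
      4 * (poly (new_P x) z - poly (new_P x) w) - 4 * (z - w) * poly (new_R x) w"
    unfolding Q' eT_def[symmetric] r_def[symmetric] nP pb_linear basic0 using RT PT by algebra
qed

lemma pb_sum_sum:
  "pb x (\<Sum>k\<in>UNIV. c k *s f k) (\<Sum>l\<in>UNIV. d l *s h l) = (\<Sum>k\<in>UNIV. \<Sum>l\<in>UNIV. pb x (f k) (h l) * c k * d l)"
  by (simp add: pb_sum_left pb_sum_right pb_linear sum_distrib_left mult_ac) (rule sum.swap)

text \<open>Infinitesimal form of the Poisson property: the Jacobian carries the bivector at
  \<open>x\<close> to the one at the image. By \<open>bivector_eqI\<close> it suffices to compare
  evaluation covectors, where both sides obey the same generating identities.\<close>

lemma pb_lax_map_grad:
  fixes x :: "('a::real_normed_field, 'g::finite) lax"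
  assumes "x \<in> lax_domain"
  shows "pb x (lax_map_grad x k) (lax_map_grad x l) = bivec (lax_map x) k l"
proof (rule bivector_eqI)
  fix D E :: "'g coord \<Rightarrow> 'a poly" and z w :: 'a
  assume D: "D \<in> {dP, dQ, dR}" and E: "E \<in> {dP, dQ, dR}" and zw: "z \<noteq> w"
  let ?y = "lax_map x"
  let ?new = "\<lambda>D z. \<Sum>k\<in>UNIV. ev D z $ k *s lax_map_grad x k"
  note lhs = pb_new[OF assms zw] pb_new[OF assms zw[symmetric]]
  note rhs = pb_ev[where x = ?y and z = z and w = w] pb_ev[where x = ?y and z = w and w = z]
  note new = ev_new[OF assms] lax_map_new[OF assms]
  have d: "z - w \<noteq> 0" "w - z \<noteq> 0" using zw by auto
  have "pb x (?new D z) (?new E w) = pb ?y (ev D z) (ev E w)"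
  proof -
    have eq: "s = t" if "(z - w) * s = u" "(z - w) * t = u" for s t u using that d by auto
    have eq': "s = t" if "(w - z) * s = u" "(w - z) * t = u" for s t u using that d by auto
    have sym: "pb x a b = pb ?y a' b'" if "pb x b a = pb ?y b' a'" for a b a' b'
      using that pb_antisym[of x a b] pb_antisym[of ?y a' b'] by simp
    have 1: "pb x (?new dP z) (?new dP w) = pb ?y (ev dP z) (ev dP w)"
      "pb x (?new dR z) (?new dR w) = pb ?y (ev dR z) (ev dR w)"
      "pb x (?new dQ z) (?new dQ w) = pb ?y (ev dQ z) (ev dQ w)"
      unfolding new lhs rhs by (rule refl)+
    have 2: "pb x (?new dP z) (?new dQ w) = pb ?y (ev dP z) (ev dQ w)"
      by (rule eq) (unfold new lhs rhs, rule refl, rule refl)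
    have 3: "pb x (?new dP z) (?new dR w) = pb ?y (ev dP z) (ev dR w)"
      by (rule eq) (unfold new lhs rhs, rule refl, rule refl)
    have 4: "pb x (?new dQ z) (?new dR w) = pb ?y (ev dQ z) (ev dR w)"
      by (rule eq) (unfold new lhs rhs, rule refl, rule refl)
    \<comment> \<open>The three mixed brackets in reversed order follow by antisymmetry from the
      identities with \<open>z\<close> and \<open>w\<close> exchanged.\<close>
    have 5: "pb x (?new dQ z) (?new dP w) = pb ?y (ev dQ z) (ev dP w)"
      by (rule sym, rule eq') (unfold new lhs rhs, rule refl, rule refl)
    have 6: "pb x (?new dR z) (?new dP w) = pb ?y (ev dR z) (ev dP w)"
      by (rule sym, rule eq') (unfold new lhs rhs, rule refl, rule refl)
    have 7: "pb x (?new dR z) (?new dQ w) = pb ?y (ev dR z) (ev dQ w)"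
      by (rule sym, rule eq') (unfold new lhs rhs, rule refl, rule refl)
    show ?thesis using D E 1 2 3 4 5 6 7 by blast
  qed
  then show "(\<Sum>k\<in>UNIV. \<Sum>l\<in>UNIV. pb x (lax_map_grad x k) (lax_map_grad x l) * ev D z $ k * ev E w $ l) =
     (\<Sum>k\<in>UNIV. \<Sum>l\<in>UNIV. bivec (lax_map x) k l * ev D z $ k * ev E w $ l)"
    unfolding pb_sum_sum by (simp only: pb_def)
qed

text \<open>Only \<open>f \<circ> to_level\<close> is known to be differentiable. Since the image of
  the map lies in the level set, inserting this projection changes nothing near
  \<open>x\<close>.\<close>

lemma has_grad_comp_lax_map:
  fixes x :: "('a::real_normed_field, 'g::finite) lax"
  assumes x: "x \<in> lax_domain" and f: "has_grad (f \<circ> to_level) \<alpha> (lax_map x)"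
  shows "has_grad ((f \<circ> lax_map) \<circ> to_level) (\<Sum>k\<in>UNIV. \<alpha> $ k *s lax_map_grad x k) x"
proof -
  have "to_level x = x" using x by (simp add: lax_domain_def to_level_eq)
  then have "has_grad (\<lambda>y. (f \<circ> to_level) (lax_map (to_level y))) (\<Sum>k\<in>UNIV. \<alpha> $ k *s lax_map_grad x k) x"
    using f by (intro has_grad_compose has_grad_lax_map[OF x]) (simp add: comp_def)
  then show ?thesis
    by (rule has_grad_transform_eventually)
       (rule eventually_mono[OF eventually_to_level_domain[OF x]], simp add: to_level_eq lax_map_level_set)
qed

lemma poisson_map_on_lax_map: "poisson_map_on lax_domain (lax_map :: ('a::real_normed_field, 'g::finite) lax \<Rightarrow> _)"
  unfolding poisson_map_on_def ldiff_at_def diff_at_iff_has_grad lbracket_def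
proof (intro conjI ballI allI impI)
  fix x :: "('a, 'g) lax" assume x: "x \<in> lax_domain"
  show "lax_map x \<in> level_set" by (rule lax_map_level_set[OF x])
  fix f assume "\<exists>\<alpha>. has_grad (f \<circ> to_level) \<alpha> (lax_map x)"
  then obtain \<alpha> where f: "has_grad (f \<circ> to_level) \<alpha> (lax_map x)" by blast
  note f' = has_grad_comp_lax_map[OF x f]
  show "\<exists>\<alpha>. has_grad (f \<circ> lax_map \<circ> to_level) \<alpha> x" using f' by blast
  fix h assume "\<exists>\<beta>. has_grad (h \<circ> to_level) \<beta> (lax_map x)"
  then obtain \<beta> where h: "has_grad (h \<circ> to_level) \<beta> (lax_map x)" by blast
  note h' = has_grad_comp_lax_map[OF x h]
  show "bracket (f \<circ> lax_map \<circ> to_level) (h \<circ> lax_map \<circ> to_level) x =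
      bracket (f \<circ> to_level) (h \<circ> to_level) (lax_map x)"
    unfolding bracket_eq_pb[OF f' h'] bracket_eq_pb[OF f h] pb_sum_sum pb_lax_map_grad[OF x]
    by (simp only: pb_def)
qed

subsection \<open>Casimirs and involution\<close>

definition dF :: "('a::real_normed_field, 'g::finite) lax \<Rightarrow> 'g coord \<Rightarrow> 'a poly" where
  "dF x i = [:2:] * laxP x * dP i + laxQ x * dR i + dQ i * laxR x"

lemma has_pgrad_lax_F: "has_pgrad lax_F (dF x) x" for x :: "('a::real_normed_field, 'g::finite) lax"
proof -
  have "has_pgrad (\<lambda>y. laxP y * laxP y + laxQ y * laxR y)
     (\<lambda>i. (laxP x * dP i + dP i * laxP x) + (laxQ x * dR i + dQ i * laxR x)) x"
    by (intro has_pgrad_add has_pgrad_mult has_pgrad_lax)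
  moreover have "(\<lambda>i :: 'g coord. (laxP x * dP i + dP i * laxP x) + (laxQ x * dR i + dQ i * laxR x)) = dF x"
  proof
    fix i :: "'g coord"
    have "[:2:] * laxP x * dP i = laxP x * dP i + dP i * laxP x"
      by (simp add: numeral_poly[symmetric] mult.commute[of "dP i"])
    then show "(laxP x * dP i + dP i * laxP x) + (laxQ x * dR i + dQ i * laxR x) = dF x i"
      by (simp add: dF_def)
  qed
  ultimately show ?thesis by (simp add: lax_F_def[abs_def] power2_eq_square)
qed

definition grad_c :: "nat \<Rightarrow> ('a::real_normed_field, 'g::finite) lax \<Rightarrow> ('a, 'g) lax" where
  "grad_c j x = (\<chi> i. coeff (dF x i) j)"

lemma has_grad_lax_c: "has_grad (lax_c j) (grad_c j x) x"
  using has_pgrad_lax_F[of x] by (simp add: has_pgrad_def lax_c_def[abs_def] grad_c_def)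

lemma ev_dF: "ev (dF x) z = (2 * poly (laxP x) z) *s ev dP z + poly (laxQ x) z *s ev dR z + poly (laxR x) z *s ev dQ z"
  by (simp add: vec_eq_iff dF_def)

text \<open>A Lax equation: the first three right sides are entries of 2
  [L(z) - (z - w) R(z) diag(1, -1), L(w)], with L the Lax matrix. Such a derivation preserves det
  L(w) = - F(w), which is the fourth identity.\<close>

lemma pb_dF:
  fixes x :: "('a::real_normed_field, 'g::finite) lax"
  defines "P \<equiv> poly (laxP x)" and "Q \<equiv> poly (laxQ x)" and "R \<equiv> poly (laxR x)"
  shows "(z - w) * pb x (ev (dF x) z) (ev dP w) = 2 * (R z * Q w - Q z * R w)"
    "(z - w) * pb x (ev (dF x) z) (ev dQ w) = 4 * (Q z * P w - P z * Q w) + 4 * (z - w) * R z * Q w"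
    "(z - w) * pb x (ev (dF x) z) (ev dR w) = 4 * (P z * R w - R z * P w) - 4 * (z - w) * R z * R w"
    "(z - w) * pb x (ev (dF x) z) (ev (dF x) w) = 0"
proof -
  note zw = pb_ev[where x = x and z = z and w = w] and wz = pb_ev[where x = x and z = w and w = z]
  have anti: "(z - w) * pb x a b = (w - z) * pb x b a" for a b
    using pb_antisym[of x a b] by (simp add: algebra_simps)
  have QP: "(z - w) * pb x (ev dQ z) (ev dP w) = 2 * (Q w - Q z)"
    and RP: "(z - w) * pb x (ev dR z) (ev dP w) = - 2 * (R w - R z)"
    and RQ: "(z - w) * pb x (ev dR z) (ev dQ w) = 4 * (P w - P z) - 4 * (w - z) * R z"
    unfolding anti wz P_def Q_def R_def by (rule refl)+
  note zw = zw[folded P_def Q_def R_def]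
  note F = ev_dF[of x, folded P_def Q_def R_def]
  have P: "(z - w) * pb x (ev (dF x) z) (ev dP w) = 2 * (R z * Q w - Q z * R w)"
    unfolding F pb_linear zw using QP RP by algebra
  have Q: "(z - w) * pb x (ev (dF x) z) (ev dQ w) = 4 * (Q z * P w - P z * Q w) + 4 * (z - w) * R z * Q w"
    unfolding F pb_linear using RQ zw(3) zw(5) by algebra
  have R: "(z - w) * pb x (ev (dF x) z) (ev dR w) = 4 * (P z * R w - R z * P w) - 4 * (z - w) * R z * R w"
    unfolding F pb_linear using zw(2) zw(4) zw(6) by algebra
  show "(z - w) * pb x (ev (dF x) z) (ev (dF x) w) = 0"
    unfolding F[of w] pb_right_linear using P Q R by algebra
  show "(z - w) * pb x (ev (dF x) z) (ev dP w) = 2 * (R z * Q w - Q z * R w)"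
    "(z - w) * pb x (ev (dF x) z) (ev dQ w) = 4 * (Q z * P w - P z * Q w) + 4 * (z - w) * R z * Q w"
    "(z - w) * pb x (ev (dF x) z) (ev dR w) = 4 * (P z * R w - R z * P w) - 4 * (z - w) * R z * R w"
    by (rule P Q R)+
qed

text \<open>Generating polynomial of the brackets of the \<open>c\<^sub>j\<close> with a covector;
  it translates between statements about values of F and about its coefficients.\<close>

definition pbF :: "('a::real_normed_field, 'g::finite) lax \<Rightarrow> ('a, 'g) lax \<Rightarrow> 'a poly" where
  "pbF x \<beta> = (\<Sum>i\<in>UNIV. smult (\<Sum>j\<in>UNIV. bivec x i j * \<beta> $ j) (dF x i))"

lemma coeff_pbF: "coeff (pbF x \<beta>) j = pb x (grad_c j x) \<beta>"
  by (simp add: pbF_def coeff_sum pb_def grad_c_def sum_distrib_left sum_distrib_right mult_ac)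

lemma poly_pbF: "poly (pbF x \<beta>) z = pb x (ev (dF x) z) \<beta>"
  by (simp add: pbF_def poly_sum pb_def sum_distrib_left sum_distrib_right mult_ac)

lemma degree_quotient_linear:
  fixes A :: "'a::idom poly"
  assumes "\<And>n. n > N \<Longrightarrow> coeff ([:- w, 1:] * A) n = 0" "j \<ge> N" "N > 0"
  shows "coeff A j = 0"
proof (cases "A = 0")
  case False
  then have "degree ([:- w, 1:] * A) = 1 + degree A" by (subst degree_mult_eq) auto
  moreover have "degree ([:- w, 1:] * A) \<le> N" using assms(1) by (intro degree_le) auto
  ultimately show ?thesis using assms(2,3) by (intro coeff_eq_0) simp
qed simp

text \<open>By \<open>pb_dF\<close>, the bracket of F(\<zeta>) with P(w), Q(w) or R(w), multiplied
  by \<zeta> - w, has degree at most g. The bracket itself then has degree below g, so its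
  coefficients from g on vanish.\<close>

lemma pb_grad_c_high:
  fixes x :: "('a::real_normed_field, 'g::finite) lax"
  assumes "j \<ge> CARD('g)"
  shows "pb x (grad_c j x) \<beta> = 0"
proof -
  let ?g = "CARD('g)"
  have zero: "pb x (grad_c j x) (ev D w) = 0" if "D \<in> {dP, dQ, dR}" for D w
  proof -
    let ?P = "laxP x" and ?Q = "laxQ x" and ?R = "laxR x"
    note [simp] = coeff_laxQ(2) coeff_laxP(3) coeff_laxR(3)
    \<comment> \<open>P and (\<zeta> - w) R are both monic of degree g + 1, so their difference has
      degree at most g.\<close>
    have top: "coeff ?P n - (coeff ?R (n - 1) - w * coeff ?R n) = 0" if "n > ?g" for n
      using that coeff_laxP(2)[of x] coeff_laxR(2)[of x] by (cases "n = ?g + 1") auto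
    have lin: "coeff ([:- w, 1:] * p) n = coeff p (n - 1) - w * coeff p n" if "n > 0" for p :: "'a poly" and n
      using that by (cases n) auto
    have ext: "[:- w, 1:] * pbF x (ev D w) = S"
      if "\<And>z. (z - w) * pb x (ev (dF x) z) (ev D w) = poly S z" for S
      using that by (intro poly_eq_poly_eq_iff[THEN iffD1] ext)
        (simp add: poly_pbF that[symmetric] algebra_simps)
    have "coeff ([:- w, 1:] * pbF x (ev D w)) n = 0" if n: "n > ?g" for n
    proof -
      from \<open>D \<in> {dP, dQ, dR}\<close> consider "D = dP" | "D = dQ" | "D = dR" by blast
      then show ?thesis
      proof cases
        case 1
        have "[:- w, 1:] * pbF x (ev D w) = smult (2 * poly ?Q w) ?R - smult (2 * poly ?R w) ?Q"
          by (rule ext) (simp only: 1 pb_dF, simp add: algebra_simps)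
        then show ?thesis using n by simp
      next
        case 2
        have *: "[:- w, 1:] * pbF x (ev D w) = smult (4 * poly ?P w) ?Q - smult (4 * poly ?Q w) (?P - [:- w, 1:] * ?R)"
          by (rule ext) (simp only: 2 pb_dF, simp add: algebra_simps)
        show ?thesis unfolding * using n top[OF n] lin[of n ?R] by simp
      next
        case 3
        have *: "[:- w, 1:] * pbF x (ev D w) = smult (4 * poly ?R w) (?P - [:- w, 1:] * ?R) - smult (4 * poly ?P w) ?R"
          by (rule ext) (simp only: 3 pb_dF, simp add: algebra_simps)
        show ?thesis unfolding * using n top[OF n] lin[of n ?R] by simp
      qed
    qed
    moreover have "?g > 0" by simp
    ultimately have "coeff (pbF x (ev D w)) j = 0"
      using degree_quotient_linear[OF _ assms] by blast
    then show ?thesis by (simp add: coeff_pbF)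
  qed
  \<comment> \<open>The evaluation covectors span, so annihilating them means annihilating each
    coordinate covector.\<close>
  have "pb x (grad_c j x) (axis k 1) = 0" for k
  proof (rule covector_eq_0I[where Z = "{}"])
    fix D :: "'g coord \<Rightarrow> 'a poly" and z :: 'a assume "D \<in> {dP, dQ, dR}"
    then have "pb x (grad_c j x) (ev D z) = 0" by (rule zero)
    then show "(\<Sum>k\<in>UNIV. ev D z $ k * pb x (grad_c j x) (axis k 1)) = 0"
      by (simp only: pb_expand[of x "grad_c j x" "ev D z"])
  qed simp
  then show ?thesis by (subst pb_expand) simp
qed

text \<open>{F(z), F(w)} vanishes off the diagonal, hence identically as a polynomial in z;
  coefficients are then extracted in one variable after the other.\<close>

lemma pb_grad_c: "pb x (grad_c j x) (grad_c k x) = 0"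
proof -
  have "pbF x (ev (dF x) w) = 0" for w
    by (rule poly_eq_0_cofinite[of "{w}"]) (use pb_dF(4)[of _ w x] in \<open>auto simp: poly_pbF\<close>)
  then have "pb x (grad_c k x) (ev (dF x) w) = 0" for k w
    by (metis coeff_pbF coeff_0)
  then have "pb x (ev (dF x) w) (grad_c k x) = 0" for k w
    using pb_antisym[of x "ev (dF x) w"] by simp
  then have "pbF x (grad_c k x) = 0"
    by (intro poly_eq_0_cofinite[of "{}"]) (auto simp: poly_pbF)
  then show ?thesis by (metis coeff_pbF coeff_0)
qed

lemma casimir_lax_c:
  assumes "j \<ge> CARD('g)"
  shows "casimir (lax_c j :: ('a::real_normed_field, 'g::finite) lax \<Rightarrow> 'a)"
  unfolding casimir_def
proof (intro conjI allI impI)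
  show "diff_at (lax_c j) x" for x :: "('a, 'g) lax"
    using has_grad_lax_c by (auto simp: diff_at_iff_has_grad)
  show "bracket (lax_c j) h x = 0" for h and x :: "('a, 'g) lax"
  proof -
    have "bracket (lax_c j) h x = pb x (grad_c j x) (\<chi> i. partial_deriv h i x)"
      by (simp add: bracket_def pb_def has_grad_imp_partial_deriv[OF has_grad_lax_c])
    then show ?thesis using pb_grad_c_high[OF assms] by simp
  qed
qed

text \<open>\<open>to_level\<close> is a coordinate projection and equals its own transpose, so it
  acts on the gradient by the same formula.\<close>

lemma has_grad_to_level_comp:
  fixes x :: "('a::real_normed_field, 'g::finite) lax"
  assumes "has_grad f \<alpha> (to_level x)"
  shows "has_grad (f \<circ> to_level) (to_level \<alpha>) x"
proof -
  have "has_grad (\<lambda>y :: ('a, 'g) lax. to_level y $ k) (to_level (axis k 1)) x" for k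
  proof (cases "k = Inl None")
    case True
    then have "to_level y $ k = 0" "to_level (axis k 1 :: ('a, 'g) lax) = 0" for y :: "('a, 'g) lax"
      by (auto simp: to_level_def vec_eq_iff axis_def)
    then show ?thesis using has_grad_const[of 0 x] by simp
  next
    case False
    then have "to_level y $ k = y $ k" "to_level (axis k 1 :: ('a, 'g) lax) = axis k 1" for y :: "('a, 'g) lax"
      by (auto simp: to_level_def vec_eq_iff axis_def)
    then show ?thesis using has_grad_nth[of k x] by simp
  qed
  from has_grad_compose[OF this assms]
  have "has_grad (\<lambda>y. f (to_level y)) (\<Sum>k\<in>UNIV. \<alpha> $ k *s to_level (axis k 1)) x" .
  moreover have "(\<Sum>k\<in>UNIV. \<alpha> $ k *s to_level (axis k 1)) = to_level \<alpha>"
  proof -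
    have "(\<Sum>k\<in>UNIV. \<alpha> $ k * (to_level (axis k 1 :: ('a, 'g) lax)) $ i) = to_level \<alpha> $ i" for i
      by (subst sum.cong[OF refl, of _ _ "\<lambda>k. if k = i then to_level \<alpha> $ k else 0"])
         (auto simp: to_level_def axis_def)
    then show ?thesis by (simp add: vec_eq_iff)
  qed
  ultimately show ?thesis by (simp add: comp_def)
qed

lemma in_involution_lax_c: "in_involution n (lax_c :: nat \<Rightarrow> ('a::real_normed_field, 'g::finite) lax \<Rightarrow> 'a)"
  unfolding in_involution_def ldiff_at_def diff_at_iff_has_grad
  using has_grad_to_level_comp[OF has_grad_lax_c]
  by (auto simp: lbracket_eq_bracket bracket_eq_pb[OF has_grad_lax_c has_grad_lax_c] pb_grad_c)

subsection \<open>Symplectic leaves and independence\<close>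

lemma sum_UNIV_option:
  fixes f :: "'g::finite option \<Rightarrow> 'b::comm_monoid_add"
  shows "(\<Sum>i\<in>UNIV. f i) = f None + (\<Sum>k\<in>UNIV. f (Some k))"
  by (simp add: UNIV_option_conv sum.reindex)

lemma ex_expo_Some:
  assumes "n < CARD('g::finite)"
  obtains k :: "'g::finite" where "expo (Some k) = n"
proof -
  have "n \<in> range (\<lambda>k :: 'g. expo (Some k))"
    using assms bij_betw_expo_Some[where 'g = 'g] by (simp add: bij_betw_def)
  then show ?thesis using that by (auto simp: image_iff)
qed

text \<open>The Hankel matrix of the coefficients of \<open>R\<close> is antitriangular, with ones on the antidiagonal.\<close>

lemma hankel_R_inj:
  fixes x :: "('a::real_normed_field, 'g::finite) lax" and \<beta> :: "'g \<Rightarrow> 'a"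
  assumes "\<And>l :: 'g. (\<Sum>k\<in>UNIV. coeff (laxR x) (expo (Some k) + expo (Some l) + 1) * \<beta> k) = 0"
  shows "\<beta> k = 0"
proof (induction "expo (Some k)" arbitrary: k rule: less_induct)
  case less
  let ?g = "CARD('g)" and ?m = "expo (Some k)"
  have m: "?m < ?g" by (rule expo_Some_less)
  \<comment> \<open>The complementary row: its antidiagonal entry in column \<open>k\<close> is the
    leading coefficient 1 of R. Columns of smaller exponent vanish by induction, those of larger
    exponent lie beyond the degree.\<close>
  obtain l :: 'g where l: "expo (Some l) = ?g - 1 - ?m"
    using m by (elim ex_expo_Some[rotated]) auto
  have "coeff (laxR x) (expo (Some k') + expo (Some l) + 1) * \<beta> k' = (if k' = k then \<beta> k else 0)" for k'
  proof -
    consider "expo (Some k') < ?m" | "k' = k" | "expo (Some k') > ?m"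
      using inj_expo[of "Some k'" "Some k"] by fastforce
    then show ?thesis
    proof cases
      case 1
      then show ?thesis using less by auto
    next
      case 2
      then show ?thesis using m l coeff_laxR(2)[of x] by simp
    next
      case 3
      then show ?thesis using m l by (auto simp: coeff_laxR(3))
    qed
  qed
  then show ?case using assms[of l] by simp
qed

section \<open>The rank of the bivector\<close>

definition bivec_col :: "('a::real_normed_field, 'g::finite) lax \<Rightarrow> 'g coord \<Rightarrow> ('a, 'g) lax" where
  "bivec_col x j = (\<chi> i. bivec x i j)"

text \<open>The 2 g columns belonging to the non-leading coefficients of P and R, which turn out to
  be a basis of the tangent space of the leaf.\<close>

definition frame :: "('a::real_normed_field, 'g::finite) lax \<Rightarrow> 'a ^ ('g + 'g) ^ 'g coord" where
  "frame x = (\<chi> i j. case j of Inl k \<Rightarrow> bivec x i (Inl (Some k)) | Inr k \<Rightarrow> bivec x i (Inr (Inr k)))"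

lemma frame_mult: "frame x *v \<beta> =
    (\<Sum>k\<in>UNIV. \<beta> $ Inl k *s bivec_col x (Inl (Some k))) + (\<Sum>k\<in>UNIV. \<beta> $ Inr k *s bivec_col x (Inr (Inr k)))"
  by (simp add: vec_eq_iff matrix_vector_mult_def frame_def bivec_col_def sum_UNIV_Plus mult.commute)

text \<open>As {P, P} = {R, R} = 0, the rows of R see only the columns of P and conversely. Each of
  the two blocks is, up to sign, twice the Hankel matrix of R.\<close>

lemma inj_frame: "inj ((*v) (frame x))" for x :: "('a::real_normed_field, 'g::finite) lax"
proof -
  have "\<beta> = 0" if 0: "frame x *v \<beta> = 0" for \<beta>
  proof -
    have "(\<Sum>k\<in>UNIV. coeff (laxR x) (expo (Some k) + expo (Some l) + 1) * (2 * \<beta> $ Inl k)) = 0" for l :: 'g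
    proof -
      have "(frame x *v \<beta>) $ Inr (Inr l) = 0" using 0 by simp
      then show ?thesis unfolding frame_mult by (simp add: bivec_col_def mult_ac)
    qed
    then have "2 * \<beta> $ Inl k = 0" for k by (rule hankel_R_inj)
    then have l: "\<beta> $ Inl k = 0" for k by simp
    have "(\<Sum>k\<in>UNIV. coeff (laxR x) (expo (Some k) + expo (Some l) + 1) * (2 * \<beta> $ Inr k)) = 0" for l :: 'g
    proof -
      have "(frame x *v \<beta>) $ Inl (Some l) = 0" using 0 by simp
      then show ?thesis unfolding frame_mult by (simp add: bivec_col_def l sum_negf mult_ac add_ac)
    qed
    then have "2 * \<beta> $ Inr k = 0" for k by (rule hankel_R_inj)
    then have r: "\<beta> $ Inr k = 0" for k by simp
    have "\<beta> $ i = 0" for i using l r by (cases i) auto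
    then show ?thesis by (simp add: vec_eq_iff)
  qed
  then show ?thesis by (simp add: vec.inj_iff_eq_0)
qed

text \<open>The differential of \<open>c\<^bsub>g+m\<^esub>\<close> annihilates the bivector, and among the coefficients of \<open>Q\<close> it
  involves only those of index at least \<open>m\<close>, that of index \<open>m\<close> with coefficient one.\<close>

lemma bivec_col_in_range_frame:
  fixes x :: "('a::real_normed_field, 'g::finite) lax"
  shows "bivec_col x j \<in> range ((*v) (frame x))"
proof -
  let ?V = "range ((*v) (frame x))" and ?g = "CARD('g)"
  have V: "vec.subspace ?V" by (intro vec.subspace_image) simp
  have P: "bivec_col x (Inl (Some k)) \<in> ?V" and R: "bivec_col x (Inr (Inr k)) \<in> ?V" for k
  proof -
    have "bivec_col x (Inl (Some k)) = frame x *v axis (Inl k) 1"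
      "bivec_col x (Inr (Inr k)) = frame x *v axis (Inr k) 1"
      by (simp_all add: vec_eq_iff matrix_vector_mult_def axis_def frame_def bivec_col_def if_distrib[of "(*) _"] cong: if_cong)
    then show "bivec_col x (Inl (Some k)) \<in> ?V" "bivec_col x (Inr (Inr k)) \<in> ?V" by auto
  qed
  have top: "bivec_col x (Inl None) = 0" by (simp add: bivec_col_def bivec_top vec_eq_iff)
  have Q: "bivec_col x (Inr (Inl m)) \<in> ?V" for m
  proof (induction "?g - expo m" arbitrary: m rule: less_induct)
    case less
    define \<gamma> where "\<gamma> = grad_c (?g + expo m) x"
    have \<gamma>: "\<gamma> $ Inr (Inl i) = (if expo i > ?g + expo m then 0 else coeff (laxR x) (?g + expo m - expo i))" for i
      by (simp add: \<gamma>_def grad_c_def dF_def coeff_monom_mult)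
    have "\<gamma> $ i *s bivec_col x i \<in> ?V" if "i \<noteq> Inr (Inl m)" for i
    proof -
      consider "i = Inl None" | k where "i = Inl (Some k)" | k where "i = Inr (Inr k)" | k where "i = Inr (Inl k)"
        by (metis option.exhaust sum.exhaust)
      then show ?thesis
      proof cases
        case 1
        then show ?thesis using top vec.subspace_0[OF V] by simp
      next
        case 2
        then show ?thesis using P vec.subspace_scale[OF V] by simp
      next
        case 3
        then show ?thesis using R vec.subspace_scale[OF V] by simp
      next
        case (4 k)
        then have "expo k \<noteq> expo m" using that by (simp add: inj_expo)
        then consider "expo k < expo m" | "expo k > expo m" by linarith
        then show ?thesis
        proof cases
          case 1
          then have "\<gamma> $ i = 0" using 4 \<gamma>[of k] by (simp add: coeff_laxR(3))
          then show ?thesis using vec.subspace_0[OF V] by simp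
        next
          case 2
          then have "?g - expo k < ?g - expo m" using expo_le[of k] by linarith
          then show ?thesis using 4 less vec.subspace_scale[OF V] by simp
        qed
      qed
    qed
    then have rest: "(\<Sum>i\<in>UNIV - {Inr (Inl m)}. \<gamma> $ i *s bivec_col x i) \<in> ?V"
      by (intro vec.subspace_sum[OF V]) auto
    have one: "\<gamma> $ Inr (Inl m) = 1" using \<gamma>[of m] coeff_laxR(2)[of x] by simp
    have "(\<Sum>i\<in>UNIV. \<gamma> $ i *s bivec_col x i) = 0"
    proof -
      have "(\<Sum>i\<in>UNIV. \<gamma> $ i * bivec x k i) = - pb x \<gamma> (axis k 1)" for k
        unfolding pb_axis_right sum_negf[symmetric]
        by (intro sum.cong refl, subst bivec_antisym) simp
      also have "\<dots> k = 0" for k unfolding \<gamma>_def by (simp add: pb_grad_c_high)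
      finally show ?thesis by (simp add: vec_eq_iff bivec_col_def)
    qed
    moreover have "(\<Sum>i\<in>UNIV. \<gamma> $ i *s bivec_col x i) = \<gamma> $ Inr (Inl m) *s bivec_col x (Inr (Inl m))
        + (\<Sum>i\<in>UNIV - {Inr (Inl m)}. \<gamma> $ i *s bivec_col x i)"
      by (rule sum.remove) auto
    ultimately have "bivec_col x (Inr (Inl m)) = - (\<Sum>i\<in>UNIV - {Inr (Inl m)}. \<gamma> $ i *s bivec_col x i)"
      by (simp add: one eq_neg_iff_add_eq_0)
    then show ?case using vec.subspace_neg[OF V rest] by simp
  qed
  consider "j = Inl None" | k where "j = Inl (Some k)" | k where "j = Inr (Inr k)" | k where "j = Inr (Inl k)"
    by (metis option.exhaust sum.exhaust)
  then show ?thesis using P Q R top vec.subspace_0[OF V] by cases auto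
qed

lemma leaf_tangent_eq: "leaf_tangent x = range ((*v) (frame x))" for x :: "('a::real_normed_field, 'g::finite) lax"
proof -
  have leaf: "(\<chi> i. \<Sum>j\<in>UNIV. bivec x i j * \<alpha> $ j) = (\<Sum>j\<in>UNIV. \<alpha> $ j *s bivec_col x j)" for \<alpha> :: "('a, 'g) lax"
    by (simp add: vec_eq_iff bivec_col_def mult.commute)
  show ?thesis
  proof
    show "leaf_tangent x \<subseteq> range ((*v) (frame x))"
      unfolding leaf_tangent_def leaf
      using bivec_col_in_range_frame[of x]
      by (auto intro!: vec.subspace_sum vec.subspace_scale vec.subspace_image)
    show "range ((*v) (frame x)) \<subseteq> leaf_tangent x"
    proof safe
      fix \<beta> :: "'a ^ ('g + 'g)"
      define \<alpha> :: "('a, 'g) lax" where "\<alpha> = (\<chi> j. case j of Inl None \<Rightarrow> 0 | Inl (Some k) \<Rightarrow> \<beta> $ Inl k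
         | Inr (Inl _) \<Rightarrow> 0 | Inr (Inr k) \<Rightarrow> \<beta> $ Inr k)"
      have "frame x *v \<beta> = (\<Sum>j\<in>UNIV. \<alpha> $ j *s bivec_col x j)"
        unfolding frame_mult by (simp add: sum_coord sum_UNIV_option \<alpha>_def)
      then show "frame x *v \<beta> \<in> leaf_tangent x"
        unfolding leaf_tangent_def leaf by blast
    qed
  qed
qed

lemma dim_leaf_tangent: "vec.dim (leaf_tangent x) = 2 * CARD('g)"
  for x :: "('a::real_normed_field, 'g::finite) lax"
proof -
  have "vec.dim (range ((*v) (frame x))) = vec.dim (UNIV :: ('a ^ ('g + 'g)) set)"
    by (rule vec.dim_image_eq) (auto intro: inj_on_subset[OF inj_frame])
  also have "\<dots> = 2 * CARD('g)" unfolding vec_dim_card by simp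
  finally show ?thesis unfolding leaf_tangent_eq .
qed

section \<open>The Bezout matrix and generic independence\<close>

lemma det_perturb:
  fixes A H :: "'a::real_normed_field ^ 'n::finite ^ 'n"
  assumes "det H \<noteq> 0" "e > 0"
  obtains t where "norm t < e" "det (\<chi> i j. A $ i $ j + t * H $ i $ j) \<noteq> 0"
proof -
  \<comment> \<open>The reversed pencil H + s A is used because its determinant at s = 0 is that of
    \<open>H\<close>, so the polynomial is nonzero. The required t is 1 / s for large s.\<close>
  define p where "p = det (\<chi> i j. [:H $ i $ j, A $ i $ j:])"
  have p: "poly p s = det (\<chi> i j. H $ i $ j + s * A $ i $ j)" for s
    unfolding p_def det_def by (simp add: poly_sum poly_prod)
  have "p \<noteq> 0"
  proof
    assume "p = 0"
    then have "poly p 0 = 0" by simp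
    then show False using assms(1) unfolding p by (simp add: vec_lambda_eta)
  qed
  then have "finite {s. poly p s = 0}" by (rule poly_roots_finite)
  then have fin: "finite {n :: nat. poly p (of_nat n) = 0}"
    using finite_vimageI[of "{s. poly p s = 0}" of_nat] by (simp add: vimage_def inj_of_nat)
  \<comment> \<open>Natural numbers serve as s: infinitely many are not roots, and their inverses
    become arbitrarily small in norm.\<close>
  obtain N :: nat where N: "inverse (real (Suc N)) < e" using reals_Archimedean[OF assms(2)] by blast
  have "\<not> {Suc N..} \<subseteq> {n :: nat. poly p (of_nat n) = 0}"
    using fin infinite_Ici[of "Suc N"] finite_subset by blast
  then obtain n where n: "n \<ge> Suc N" "poly p (of_nat n) \<noteq> 0" by auto
  let ?s = "of_nat n :: 'a"
  have s: "?s \<noteq> 0" using n(1) by simp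
  have "det (\<chi> i j. H $ i $ j + ?s * A $ i $ j) = det (\<chi> i. ?s *s (\<chi> j. A $ i $ j + inverse ?s * H $ i $ j))"
    using s by (intro arg_cong[where f = det]) (simp add: vec_eq_iff field_simps)
  also have "\<dots> = ?s ^ CARD('n) * det (\<chi> i j. A $ i $ j + inverse ?s * H $ i $ j)"
    by (subst det_rows_mul) simp
  finally have "det (\<chi> i j. A $ i $ j + inverse ?s * H $ i $ j) \<noteq> 0" using n(2) by (simp add: p)
  moreover have "norm (inverse ?s) < e"
  proof -
    have "norm (inverse ?s) = inverse (real n)" by (simp add: norm_inverse)
    also have "\<dots> \<le> inverse (real (Suc N))" using n(1) by (simp add: field_simps)
    finally show ?thesis using N by simp
  qed
  ultimately show ?thesis using that by blast
qed

text \<open>By \<open>pb_dF\<close> the generating function of the entries is 2 (R(z) Q(w) - Q(z)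
  R(w)) / (z - w), columns counting powers of z and rows powers of w.\<close>

definition bezout :: "('a::real_normed_field, 'g::finite) lax \<Rightarrow> 'a ^ 'g ^ 'g" where
  "bezout x = (\<chi> l m. pb x (grad_c (expo (Some m)) x) (axis (Inl (Some l)) 1))"

lemma bezout_nth:
  fixes x :: "('a::real_normed_field, 'g::finite) lax"
  shows "bezout x $ l $ m =
    (\<Sum>k\<in>UNIV. 2 * coeff (laxR x) (expo (Some l) + expo (Some (k :: 'g)) + 1) * coeff (laxQ x * monom 1 (expo (Some k))) (expo (Some m)))
    - (\<Sum>i\<in>UNIV. 2 * coeff (laxQ x) (expo (i :: 'g option) + expo (Some l) + 1) * coeff (monom 1 (expo i) * laxR x) (expo (Some m)))"
  by (simp add: bezout_def pb_axis_right sum_coord grad_c_def dF_def sum_negf)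

definition hankel_R :: "('a::real_normed_field, 'g::finite) lax \<Rightarrow> 'a ^ 'g ^ 'g" where
  "hankel_R x = (\<chi> l m. 2 * coeff (laxR x) (expo (Some l) + expo (Some m) + 1))"

lemma det_hankel_R: "det (hankel_R x) \<noteq> 0" for x :: "('a::real_normed_field, 'g::finite) lax"
proof -
  have "\<beta> = 0" if 0: "hankel_R x *v \<beta> = 0" for \<beta>
  proof -
    have "(\<Sum>k\<in>UNIV. coeff (laxR x) (expo (Some k) + expo (Some l) + 1) * (2 * \<beta> $ k)) = 0" for l :: 'g
    proof -
      have "(hankel_R x *v \<beta>) $ l = 0" using 0 by simp
      then show ?thesis by (simp add: matrix_vector_mult_def hankel_R_def mult_ac add.commute)
    qed
    then have "2 * \<beta> $ k = 0" for k by (rule hankel_R_inj)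
    then show ?thesis by (simp add: vec_eq_iff)
  qed
  then show ?thesis
    by (simp add: invertible_det_nz[symmetric] invertible_left_inverse matrix_left_invertible_ker)
qed

text \<open>Replacing Q by Q + t changes the generating function by 2 t (R(z) - R(w)) / (z - w),
  which generates the Hankel matrix of R.\<close>

lemma bezout_perturb:
  fixes x :: "('a::real_normed_field, 'g::finite) lax"
  assumes i0: "expo i0 = 0"
  shows "bezout (x + axis (Inr (Inl i0)) t) $ l $ m = bezout x $ l $ m + t * hankel_R x $ l $ m"
proof -
  let ?y = "x + axis (Inr (Inl i0)) t"
  have Q: "laxQ ?y = laxQ x + [:t:]"
  proof -
    have "laxQ ?y = laxQ x + (\<Sum>i\<in>UNIV. monom ((axis (Inr (Inl i0)) t :: ('a, 'g) lax) $ Inr (Inl i)) (expo i))"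
      by (simp add: laxQ_def sum.distrib add_monom[symmetric])
    also have "(\<Sum>i\<in>UNIV. monom ((axis (Inr (Inl i0)) t :: ('a, 'g) lax) $ Inr (Inl i)) (expo i)) = [:t:]"
      by (subst sum.cong[OF refl, of _ _ "\<lambda>i. if i = i0 then [:t:] else 0"])
         (auto simp: axis_def i0 monom_0)
    finally show ?thesis .
  qed
  have R: "laxR ?y = laxR x" by (simp add: laxR_def axis_def)
  have delta: "(\<Sum>k\<in>UNIV. 2 * coeff (laxR x) (expo (Some l) + expo (Some (k :: 'g)) + 1) * (t * coeff (monom 1 (expo (Some k))) (expo (Some m))))
     = t * hankel_R x $ l $ m"
    by (subst sum.cong[OF refl, of _ _ "\<lambda>k. if k = m then t * hankel_R x $ l $ m else 0"])
       (auto simp: inj_expo hankel_R_def)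
  \<comment> \<open>The second sum in \<open>bezout_nth\<close> contains only coefficients of Q of
    positive index and is unaffected; the first contributes the Hankel term.\<close>
  have "coeff (laxQ ?y) (Suc n) = coeff (laxQ x) (Suc n)" for n by (simp add: Q)
  moreover have "coeff (laxQ ?y * monom 1 n) k = coeff (laxQ x * monom 1 n) k + t * coeff (monom 1 n) k" for n k
    by (simp add: Q distrib_right)
  ultimately show ?thesis
    unfolding bezout_nth R delta[symmetric] by (simp add: distrib_left sum.distrib)
qed

lemma has_grad_continuous: "has_grad f d x \<Longrightarrow> isCont f x"
  unfolding has_grad_def by (rule has_derivative_continuous)

lemma continuous_on_coeff_mult [continuous_intros]:
  fixes p q :: "'b::topological_space \<Rightarrow> 'a::real_normed_field poly"
  assumes "\<And>n. continuous_on S (\<lambda>x. coeff (p x) n)" "\<And>n. continuous_on S (\<lambda>x. coeff (q x) n)"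
  shows "continuous_on S (\<lambda>x. coeff (p x * q x) n)"
  unfolding coeff_mult using assms by (intro continuous_intros)

text \<open>The determinant is a polynomial expression in the coefficients of Q and R.\<close>

lemma continuous_on_det_bezout:
  "continuous_on UNIV (\<lambda>x :: ('a::real_normed_field, 'g::finite) lax. det (bezout x))"
proof -
  have "continuous_on UNIV (\<lambda>x :: ('a, 'g) lax. coeff (laxQ x) n)" "continuous_on UNIV (\<lambda>x :: ('a, 'g) lax. coeff (laxR x) n)" for n
    by (rule continuous_at_imp_continuous_on, rule ballI, rule has_grad_continuous,
        rule has_pgrad_lax[unfolded has_pgrad_def, rule_format])+
  then show ?thesis
    unfolding det_def bezout_nth
    by (intro continuous_intros) auto
qed

lemma maximal_independent_lax_c:
  "maximal_independent CARD('g) (lax_c :: nat \<Rightarrow> ('a::real_normed_field, 'g::finite) lax \<Rightarrow> 'a)"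
proof -
  \<comment> \<open>Nonvanishing of the determinant is an open condition and, at each point, forces
    independence of the differentials along the leaf.\<close>
  define W :: "('a, 'g) lax set" where "W = {x \<in> level_set. det (bezout x) \<noteq> 0}"
  have "openin (top_of_set level_set) W"
  proof -
    have "open {x :: ('a, 'g) lax. det (bezout x) \<noteq> 0}"
      by (intro open_Collect_neq continuous_on_det_bezout continuous_on_const)
    moreover have "W = level_set \<inter> {x. det (bezout x) \<noteq> 0}" by (auto simp: W_def)
    ultimately show ?thesis by (auto simp: openin_open)
  qed
  moreover have "level_set \<subseteq> closure W"
  proof
    fix x :: "('a, 'g) lax" assume x: "x \<in> level_set"
    show "x \<in> closure W"
      unfolding closure_approachable
    proof (intro allI impI)
      fix e :: real assume "e > 0"
      obtain t where t: "norm t < e" "det (\<chi> l m. bezout x $ l $ m + t * hankel_R x $ l $ m) \<noteq> 0"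
        using det_perturb[OF det_hankel_R[of x] \<open>e > 0\<close>, of "bezout x"] .
      obtain i0 :: 'g where i0: "expo (Some i0) = 0"
        using ex_expo_Some[of 0] by auto
      \<comment> \<open>The constant term of Q is free on the level set, so this small perturbation
        stays inside it.\<close>
      let ?y = "x + axis (Inr (Inl (Some i0))) t"
      have "bezout ?y = (\<chi> l m. bezout x $ l $ m + t * hankel_R x $ l $ m)"
        by (simp add: vec_eq_iff bezout_perturb[OF i0])
      moreover have "?y \<in> level_set" using x by (simp add: level_set_iff axis_def)
      moreover have "dist ?y x < e" using t(1) by (simp add: dist_norm norm_axis)
      ultimately show "\<exists>y\<in>W. dist y x < e" using t(2) by (intro bexI[of _ ?y]) (auto simp: W_def)
    qed
  qed
  moreover have "a j = 0"
    if W: "x \<in> W" and a: "\<forall>v\<in>leaf_tangent x. (\<Sum>j<CARD('g). a j * ldifferential (lax_c j) x v) = 0"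
      and j: "j < CARD('g)" for x :: "('a, 'g) lax" and a :: "nat \<Rightarrow> 'a" and j
  proof -
    have x: "to_level x = x" using W by (simp add: W_def to_level_eq)
    have ld: "ldifferential (lax_c j) x v = (\<Sum>i\<in>UNIV. to_level (grad_c j x) $ i * v $ i)" for j v
    proof -
      have "has_grad (lax_c j \<circ> to_level) (to_level (grad_c j x)) x"
        by (rule has_grad_to_level_comp) (simp add: x has_grad_lax_c)
      then show ?thesis by (simp add: ldifferential_def has_grad_imp_partial_deriv)
    qed
    have "(\<Sum>j<CARD('g). a j * pb x (grad_c j x) (axis (Inl (Some l)) 1)) = 0" for l :: 'g
    proof -
      \<comment> \<open>Testing on the Hamiltonian vectors of the lower coefficients of P is enough.
        The component removed by \<open>to_level\<close> meets a zero row of the bivector.\<close>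
      have "ldifferential (lax_c j) x (bivec_col x (Inl (Some l))) = pb x (grad_c j x) (axis (Inl (Some l)) 1)" for j
        unfolding ld pb_axis_right
        by (intro sum.cong refl) (auto simp: to_level_def bivec_col_def bivec_top)
      moreover have "bivec_col x (Inl (Some l)) \<in> leaf_tangent x"
        unfolding leaf_tangent_eq by (rule bivec_col_in_range_frame)
      ultimately show ?thesis using a by fastforce
    qed
    \<comment> \<open>The vanishing combination, tested on these vectors, says that the coefficient
      vector lies in the kernel of the Bezout matrix.\<close>
    then have "bezout x *v (\<chi> m. a (expo (Some m))) = 0"
      unfolding sum_expo_Some[symmetric] by (simp add: vec_eq_iff matrix_vector_mult_def bezout_def mult.commute)
    moreover have "\<exists>B. B ** bezout x = mat 1"
      using W by (simp add: W_def invertible_det_nz[symmetric] invertible_left_inverse)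
    ultimately have "(\<chi> m. a (expo (Some (m :: 'g)))) = 0" unfolding matrix_left_invertible_ker by blast
    then have "a (expo (Some (m :: 'g))) = 0" for m by (metis vec_lambda_beta zero_index)
    then show ?thesis using ex_expo_Some[OF j] by metis
  qed
  ultimately show ?thesis
    unfolding maximal_independent_def using dim_leaf_tangent[where 'a = 'a and 'g = 'g] by blast
qed

section \<open>Assembly of integrability and the Casimirs\<close>

theorem theorem6p2:
  defines "g \<equiv> CARD('g::finite)"
    and "D \<equiv> (lax_domain :: ('a::real_normed_field, 'g) lax set)"
    and "\<Phi> \<equiv> (lax_map :: ('a, 'g) lax \<Rightarrow> ('a, 'g) lax)"
    and "c \<equiv> (lax_c :: nat \<Rightarrow> ('a, 'g) lax \<Rightarrow> 'a)"
  shows "(\<forall>x\<in>D. \<exists>!y. lax_step x y) \<and>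
    (\<forall>x\<in>D. \<forall>y. lax_step x y \<longleftrightarrow> lax_matrix x ** lax_M x = lax_M x ** lax_matrix y) \<and>
    integrable_poisson_map_on D \<Phi> g c \<and>
    (\<forall>j\<in>{g..2 * g + 1}. casimir (c j) \<and> (\<forall>x\<in>D. c j (\<Phi> x) = c j x))"
proof -
  \<comment> \<open>Conservation of F as a polynomial covers Hamiltonians and Casimirs at
    once.\<close>
  have "c j (\<Phi> x) = c j x" if "x \<in> D" for j x
    using lax_F_lax_map[of x] that unfolding D_def \<Phi>_def c_def by (simp add: lax_c_def)
  moreover have "poisson_map_on D \<Phi>" "in_involution g c" "maximal_independent g c"
    unfolding D_def \<Phi>_def c_def g_def
    by (rule poisson_map_on_lax_map in_involution_lax_c maximal_independent_lax_c)+
  moreover have "casimir (c j)" if "j \<ge> g" for j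
    using that unfolding c_def g_def by (rule casimir_lax_c)
  moreover have "\<forall>x\<in>D. \<exists>!y. lax_step x y"
    unfolding D_def using lax_step_unique_exists by blast
  moreover have "\<forall>x\<in>D. \<forall>y. lax_step x y \<longleftrightarrow> lax_matrix x ** lax_M x = lax_M x ** lax_matrix y"
    unfolding D_def lax_domain_def using lax_step_iff_matrix by blast
  ultimately show ?thesis unfolding integrable_poisson_map_on_def by simp
qed

end
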